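(* The following assertions hold for semigroups of self-maps of the unit disk. (i) Given a parabolic or hyperbolic linear fractional self-map $\varphi$ of $\mathbb{D}$ and a positive number $s$, there is a unique semigroup $\mathcal{G}=\{g_t: t\in[0,\infty)\}$ of self-maps of $\mathbb{D}$ such that $g_s=\varphi$. Every elliptic disk automorphism is a member of some semigroup (not necessarily unique). (ii) Let $\varphi$ be an elliptic, non-automorphic, linear fractional self-map of $\mathbb{D}$ with Denjoy-Wolff point $p\in\mathbb{D}$, and write its conjugate $\varphi_p\circ\varphi\circ\varphi_p$ in the form $z\mapsto \dfrac{Az}{Cz+1}$, where $|A|+|C|\le1$. Then $\varphi$ belongs to some semigroup of self-maps of the disk if and only if there exists a sequence $\{a_n\}_{n=0}^\infty$ such that $a_0=A$, every $a_n$ ($n\ge1$) is one of the square roots of the number $a_{n-1}$, and all $a_n$ belong to the region $$S=\left\{z\in\mathbb{D}:\ \frac{|C|}{|1-A|}\,|1-z|\le 1-|z|\right\}.$$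
   Context: $\mathbb{D}$ is the open unit disk in $\mathbb{C}$. A self-map of $\mathbb{D}$ is a function analytic in $\mathbb{D}$ with $f(\mathbb{D})\subset\mathbb{D}$. A linear fractional self-map of $\mathbb{D}$ is a self-map of the form $z\mapsto (az+b)/(cz+d)$ with $ad-bc\ne0$. An automorphism is a bijective self-map of $\mathbb{D}$; non-automorphic means not an automorphism. A semigroup of self-maps of $\mathbb{D}$ is a family $\mathcal{G}=\{g_t: t\in[0,\infty)\}$ of analytic self-maps of $\mathbb{D}$ such that $g_0$ is the identity, $g_s\circ g_t=g_{s+t}$ for all $s,t\in[0,\infty)$, and $t\mapsto g_t$ is strongly continuous: $g_s\to g_t$ uniformly on compact subsets of $\mathbb{D}$ as $s\to t$. A map $\varphi$ is a member of (belongs to) $\mathcal{G}$ if $\varphi=g_t$ for some $t\ge 0$. A non-identity self-map $g$ of $\mathbb{D}$ is elliptic if it has a (necessarily unique) fixed point in $\mathbb{D}$, which is then its Denjoy-Wolff point. Otherwise its Denjoy-Wolff point is the unique point $p\in\partial\mathbb{D}$ to which the iterates of $g$ converge uniformly on compact subsets of $\mathbb{D}$, and $g$ is hyperbolic if its (angular) derivative satisfies $g'(p)<1$ and parabolic if $g'(p)=1$ (always $0<g'(p)\le1$). For $p\in\mathbb{D}$, $\varphi_p(z)=\dfrac{p-z}{1-\overline{p}z}$. *)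

theory Defs
  imports "HOL-Complex_Analysis.Complex_Analysis"
begin

text \<open>
  Self-maps of the disk are total functions on \<^typ>\<open>complex\<close> of which only the values on the disk
  matter. All notions below, including equality of maps, refer to the restriction to the disk.
\<close>

abbreviation unit_disk :: "complex set" where
  "unit_disk \<equiv> ball 0 1"

definition eq_on_disk :: "(complex \<Rightarrow> complex) \<Rightarrow> (complex \<Rightarrow> complex) \<Rightarrow> bool" where
  "eq_on_disk f g \<longleftrightarrow> (\<forall>z\<in>unit_disk. f z = g z)"

definition self_map :: "(complex \<Rightarrow> complex) \<Rightarrow> bool" where
  "self_map f \<longleftrightarrow> f holomorphic_on unit_disk \<and> f ` unit_disk \<subseteq> unit_disk"

text \<open>The denominator is required not to vanish because \<open>x / 0 = 0\<close>.\<close>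

definition linear_fractional_self_map :: "(complex \<Rightarrow> complex) \<Rightarrow> bool" where
  "linear_fractional_self_map f \<longleftrightarrow> self_map f \<and>
     (\<exists>a b c d. a * d - b * c \<noteq> 0 \<and>
        (\<forall>z\<in>unit_disk. c * z + d \<noteq> 0 \<and> f z = (a * z + b) / (c * z + d)))"

definition disk_automorphism :: "(complex \<Rightarrow> complex) \<Rightarrow> bool" where
  "disk_automorphism f \<longleftrightarrow> self_map f \<and> bij_betw f unit_disk unit_disk"

definition disk_semigroup :: "(real \<Rightarrow> complex \<Rightarrow> complex) \<Rightarrow> bool" where
  "disk_semigroup g \<longleftrightarrow>
     (\<forall>t\<ge>0. self_map (g t)) \<and>
     eq_on_disk (g 0) id \<and>
     (\<forall>s\<ge>0. \<forall>t\<ge>0. eq_on_disk (g s \<circ> g t) (g (s + t))) \<and>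
     (\<forall>t\<ge>0. \<forall>K. compact K \<and> K \<subseteq> unit_disk \<longrightarrow> uniform_limit K g (g t) (at t within {0..}))"

definition eq_semigroup ::
    "(real \<Rightarrow> complex \<Rightarrow> complex) \<Rightarrow> (real \<Rightarrow> complex \<Rightarrow> complex) \<Rightarrow> bool" where
  "eq_semigroup g h \<longleftrightarrow> (\<forall>t\<ge>0. eq_on_disk (g t) (h t))"

definition member_of_semigroup ::
    "(complex \<Rightarrow> complex) \<Rightarrow> (real \<Rightarrow> complex \<Rightarrow> complex) \<Rightarrow> bool" where
  "member_of_semigroup f g \<longleftrightarrow> (\<exists>t\<ge>0. eq_on_disk f (g t))"

definition elliptic :: "(complex \<Rightarrow> complex) \<Rightarrow> bool" where
  "elliptic f \<longleftrightarrow> self_map f \<and> \<not> eq_on_disk f id \<and> (\<exists>p\<in>unit_disk. f p = p)"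

definition denjoy_wolff_point :: "(complex \<Rightarrow> complex) \<Rightarrow> complex \<Rightarrow> bool" where
  "denjoy_wolff_point f p \<longleftrightarrow> self_map f \<and> \<not> eq_on_disk f id \<and>
     (if elliptic f then p \<in> unit_disk \<and> f p = p
      else p \<in> sphere 0 1 \<and>
        (\<forall>K. compact K \<and> K \<subseteq> unit_disk \<longrightarrow>
           uniform_limit K (\<lambda>n. f ^^ n) (\<lambda>_. p) sequentially))"

definition stolz_region :: "complex \<Rightarrow> real \<Rightarrow> complex set" where
  "stolz_region p M = {z \<in> unit_disk. norm (p - z) < M * (1 - norm z)}"

text \<open>
  The angular derivative at a boundary point \<open>p\<close> is the non-tangential limit of the difference
  quotient formed with a boundary value \<open>w\<close> of modulus one; this limit forces \<open>w\<close> to be the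
  angular limit of \<open>f\<close> at \<open>p\<close>.
\<close>

definition has_angular_derivative :: "(complex \<Rightarrow> complex) \<Rightarrow> complex \<Rightarrow> complex \<Rightarrow> bool" where
  "has_angular_derivative f D p \<longleftrightarrow>
     (\<exists>w\<in>sphere 0 1. \<forall>M>1.
        ((\<lambda>z. (f z - w) / (z - p)) \<longlongrightarrow> D) (at p within stolz_region p M))"

definition hyperbolic :: "(complex \<Rightarrow> complex) \<Rightarrow> bool" where
  "hyperbolic f \<longleftrightarrow> self_map f \<and> \<not> eq_on_disk f id \<and> \<not> elliptic f \<and>
     (\<exists>p. denjoy_wolff_point f p \<and>
        (\<exists>d::real. has_angular_derivative f (of_real d) p \<and> d < 1))"

definition parabolic :: "(complex \<Rightarrow> complex) \<Rightarrow> bool" where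
  "parabolic f \<longleftrightarrow> self_map f \<and> \<not> eq_on_disk f id \<and> \<not> elliptic f \<and>
     (\<exists>p. denjoy_wolff_point f p \<and> has_angular_derivative f 1 p)"

definition disk_involution :: "complex \<Rightarrow> complex \<Rightarrow> complex" where
  "disk_involution p z = (p - z) / (1 - cnj p * z)"

definition conjugate_form :: "(complex \<Rightarrow> complex) \<Rightarrow> complex \<Rightarrow> complex \<Rightarrow> complex \<Rightarrow> bool" where
  "conjugate_form f p A C \<longleftrightarrow> norm A + norm C \<le> 1 \<and>
     (\<forall>z\<in>unit_disk. C * z + 1 \<noteq> 0 \<and>
        (disk_involution p \<circ> f \<circ> disk_involution p) z = A * z / (C * z + 1))"

definition root_region :: "complex \<Rightarrow> complex \<Rightarrow> complex set" where
  "root_region A C = {z \<in> unit_disk. norm C / norm (1 - A) * norm (1 - z) \<le> 1 - norm z}"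

end

theory Submission
  imports Defs
begin

text \<open>
  Everything happens in a coordinate in which \<open>\<phi>\<close> is as simple as possible. The members of a
  semigroup through \<open>\<phi>\<close> commute with \<open>\<phi>\<close>, and some of them are iterative roots of \<open>\<phi>\<close>; unless \<open>\<phi>\<close>
  is an elliptic automorphism, they turn out to have the same simple form as \<open>\<phi>\<close>.

  If \<open>\<phi>\<close> is parabolic or hyperbolic with Denjoy--Wolff point \<open>p\<close>, the Cayley transform sending \<open>p\<close>
  to infinity turns it into a fractional linear self-map of the right half-plane all of whose orbits
  tend to infinity. Such a map is affine, \<open>w \<mapsto> \<alpha> w + \<beta>\<close> with \<open>\<alpha> \<ge> 1\<close> and \<open>Re \<beta> \<ge> 0\<close>
  (\<open>non_elliptic_fractional_linear_is_affine\<close>), and it lies in an evident semigroup of affine maps.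
  For uniqueness it suffices that any two semigroups with the same time-\<open>s\<close> map agree at the times
  \<open>s / n\<close>, for then they agree at a dense set of times. So let \<open>F\<close> be a self-map of the half-plane
  with \<open>F ^^ n = T\<close>, where \<open>T w = \<alpha> w + \<beta>\<close>. As \<open>F\<close> commutes with \<open>T\<close>, conjugating by powers of \<open>T\<close>
  extends \<open>F\<close> to the union of the sets \<open>T\<^sup>-\<^sup>k(half-plane)\<close>, on which \<open>T\<close>, and hence the
  extension, is bijective. That union is the whole plane if \<open>\<alpha> = 1\<close> and \<open>Re \<beta> > 0\<close>, and there
  Liouville's theorem shows that the extension is a translation. Otherwise it is a half-plane, the
  extension is one of its automorphisms, and commuting with \<open>T\<close> makes it fix infinity. Either way \<open>F\<close>
  is affine with positive multiplier (\<open>half_plane_root_of_affine_is_affine\<close>), and affine maps with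
  positive multiplier have at most one such \<open>n\<close>-th root (\<open>affine_map_funpow_root_unique\<close>).

  If \<open>\<phi>\<close> fixes \<open>p\<close> in the disk, conjugation by the involution \<open>disk_involution p\<close> moves the fixed point
  to \<open>0\<close>. An elliptic automorphism becomes a rotation by the Schwarz lemma, and rotations lie in
  semigroups of rotations; turning in either direction gives two different semigroups through
  \<open>z \<mapsto> - z\<close>. In the non-automorphic case \<open>\<phi>\<close> becomes \<open>z \<mapsto> A z / (C z + 1)\<close> with
  \<open>0 < \<bar>A\<bar> < 1\<close>. With \<open>k = C / (1 - A)\<close>, the function \<open>z / (1 + k z)\<close> conjugates this map to
  multiplication by \<open>A\<close>, and a self-map fixing \<open>0\<close> and commuting with it is conjugated to
  multiplication by some \<open>a\<close> (\<open>commuting_with_linear_model\<close>). The corresponding map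
  \<open>a z / ((1 - a) k z + 1)\<close> takes the disk into itself exactly when
  \<open>\<bar>a\<bar> + \<bar>1 - a\<bar> \<bar>k\<bar> \<le> 1\<close>, which for \<open>\<bar>a\<bar> < 1\<close> is membership in \<open>root_region A C\<close>. Hence a semigroup
  \<open>g\<close> with \<open>g t = \<phi>\<close> gives the sequence of multipliers of \<open>g (t / 2 ^ n)\<close>. Conversely, a sequence
  of iterated square roots of \<open>A\<close> in the region has moduli tending to \<open>1\<close>. If \<open>C = 0\<close>, any
  logarithm of \<open>A\<close> generates a semigroup. If \<open>C \<noteq> 0\<close>, the region is a Stolz region at \<open>1\<close>, so the
  sequence tends to \<open>1\<close> and from some index on consists of principal square roots; thus
  \<open>a n = exp (c / 2 ^ n)\<close> for large \<open>n\<close> with a single \<open>c\<close>. The region is closed under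
  multiplication, so it contains \<open>exp (t c)\<close> for all dyadic \<open>t > 0\<close>, and by continuity the defining
  inequality holds for all \<open>t \<ge> 0\<close> (\<open>square_roots_give_exponent\<close>).
\<close>

section \<open>Charts of the disk and transport of semigroups\<close>

definition right_half_plane :: "complex set" where
  "right_half_plane = {w. 0 < Re w}"

lemma open_right_half_plane: "open right_half_plane"
  unfolding right_half_plane_def by (rule open_halfspace_Re_gt)

text \<open>
  A biholomorphic map of the disk onto \<open>U\<close>, given together with its inverse because functions are
  total and only their values on \<open>unit_disk\<close> and \<open>U\<close> are meant. It is used with the Cayley transform and
  with the involution exchanging \<open>0\<close> and \<open>p\<close>.
\<close>

locale disk_chart =
  fixes U :: "complex set" and k k' :: "complex \<Rightarrow> complex"
  assumes holomorphic: "k holomorphic_on unit_disk"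
    and inv_holomorphic: "k' holomorphic_on U"
    and maps_to: "\<And>z. z \<in> unit_disk \<Longrightarrow> k z \<in> U"
    and inv_maps_to: "\<And>w. w \<in> U \<Longrightarrow> k' w \<in> unit_disk"
    and left_inv: "\<And>z. z \<in> unit_disk \<Longrightarrow> k' (k z) = z"
    and right_inv: "\<And>w. w \<in> U \<Longrightarrow> k (k' w) = w"
begin

lemma self_map_pull_back:
  assumes "G holomorphic_on U" and "\<And>w. w \<in> U \<Longrightarrow> G w \<in> U"
  shows "self_map (k' \<circ> G \<circ> k)"
proof -
  have "k' \<circ> G \<circ> k holomorphic_on unit_disk"
  proof (rule holomorphic_on_compose_gen[where t = U])
    show "k holomorphic_on unit_disk"
      by (rule holomorphic)
    show "k' \<circ> G holomorphic_on U"
      by (rule holomorphic_on_compose_gen[OF assms(1) inv_holomorphic]) (use assms(2) in blast)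
    show "k ` unit_disk \<subseteq> U"
      using maps_to by blast
  qed
  thus ?thesis
    using maps_to inv_maps_to assms(2) by (auto simp: self_map_def)
qed

lemma push_forward_holomorphic:
  assumes "self_map f"
  shows "k \<circ> f \<circ> k' holomorphic_on U"
proof (rule holomorphic_on_compose_gen[where t = unit_disk])
  show "k' holomorphic_on U"
    by (rule inv_holomorphic)
  have f: "f holomorphic_on unit_disk" "f ` unit_disk \<subseteq> unit_disk"
    using assms by (auto simp: self_map_def)
  show "k \<circ> f holomorphic_on unit_disk"
    by (rule holomorphic_on_compose_gen[OF f(1) holomorphic f(2)])
  show "k' ` U \<subseteq> unit_disk"
    using inv_maps_to by blast
qed

lemma push_forward_maps_to:
  assumes "self_map f" "w \<in> U"
  shows "(k \<circ> f \<circ> k') w \<in> U"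
  using assms maps_to inv_maps_to by (auto simp: self_map_def image_subset_iff)

text \<open>
  Joint continuity in time and space on \<open>[0, \<infinity>) \<times> U\<close> gives uniform convergence on compact sets
  by the tube lemma, and unlike uniform convergence it is visible from a formula for \<open>G\<close>.
\<close>

lemma disk_semigroup_pull_back:
  assumes hol: "\<And>t. 0 \<le> t \<Longrightarrow> G t holomorphic_on U"
    and into: "\<And>t w. 0 \<le> t \<Longrightarrow> w \<in> U \<Longrightarrow> G t w \<in> U"
    and zero: "\<And>w. w \<in> U \<Longrightarrow> G 0 w = w"
    and add: "\<And>s t w. 0 \<le> s \<Longrightarrow> 0 \<le> t \<Longrightarrow> w \<in> U \<Longrightarrow> G s (G t w) = G (s + t) w"
    and cont: "continuous_on ({0..} \<times> U) (\<lambda>(t, w). G t w)"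
  shows "disk_semigroup (\<lambda>t. k' \<circ> G t \<circ> k)"
  unfolding disk_semigroup_def
proof (intro conjI allI impI)
  fix t :: real assume "0 \<le> t"
  thus "self_map (k' \<circ> G t \<circ> k)"
    by (intro self_map_pull_back hol into)
next
  show "eq_on_disk (k' \<circ> G 0 \<circ> k) id"
    using zero maps_to left_inv by (auto simp: eq_on_disk_def)
next
  fix s t :: real assume st: "0 \<le> s" "0 \<le> t"
  show "eq_on_disk ((k' \<circ> G s \<circ> k) \<circ> (k' \<circ> G t \<circ> k)) (k' \<circ> G (s + t) \<circ> k)"
    unfolding eq_on_disk_def using st maps_to right_inv into add by auto
next
  fix t :: real and K :: "complex set"
  assume t: "0 \<le> t" and K: "compact K \<and> K \<subseteq> unit_disk"
  have k: "continuous_on K k"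
    using holomorphic K holomorphic_on_imp_continuous_on continuous_on_subset by blast
  have img: "k ` K \<subseteq> U"
    using maps_to K by blast
  have "continuous_on ({0..} \<times> K) (\<lambda>(t, z). G t (k z))"
  proof -
    have c: "continuous_on ({0..} \<times> K) (\<lambda>p. (fst p, k (snd p)))"
      by (intro continuous_intros continuous_on_compose2[OF k]) auto
    have "(\<lambda>p. (fst p, k (snd p))) ` ({0..} \<times> K) \<subseteq> {0..} \<times> U"
      using img by auto
    from continuous_on_compose2[OF cont c this] show ?thesis
      by (simp add: case_prod_unfold)
  qed
  moreover have "continuous_on U k'"
    using inv_holomorphic holomorphic_on_imp_continuous_on by blast
  ultimately have joint: "continuous_on ({0..} \<times> K) (\<lambda>(t, z). k' (G t (k z)))"
    using img into unfolding case_prod_unfold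
    by (elim continuous_on_compose2[where g = k', rotated]) auto
  show "uniform_limit K (\<lambda>t. k' \<circ> G t \<circ> k) (k' \<circ> G t \<circ> k) (at t within {0..})"
  proof (rule uniform_limitI)
    fix e :: real assume "0 < e"
    hence e: "0 < e / 2" by simp
    obtain X where X: "t \<in> X" "open X"
      "\<forall>x\<in>X \<inter> {0..}. \<forall>z\<in>K. dist (k' (G x (k z))) (k' (G t (k z))) \<le> e / 2"
      using continuous_on_prod_compactE[OF joint _ _ e, of t] t K by (auto simp: atLeast_iff)
    have "\<forall>\<^sub>F x in at t within {0..}. x \<in> X \<inter> {0..}"
      using X(1,2) by (auto simp: eventually_at_topological)
    thus "\<forall>\<^sub>F x in at t within {0..}. \<forall>z\<in>K. dist ((k' \<circ> G x \<circ> k) z) ((k' \<circ> G t \<circ> k) z) < e"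
    proof eventually_elim
      case (elim x)
      show ?case
      proof
        fix z assume "z \<in> K"
        hence "dist (k' (G x (k z))) (k' (G t (k z))) \<le> e / 2"
          using X(3) elim by blast
        thus "dist ((k' \<circ> G x \<circ> k) z) ((k' \<circ> G t \<circ> k) z) < e"
          using \<open>0 < e\<close> by simp
      qed
    qed
  qed
qed

end

lemma one_minus_cnj_mult_nonzero:
  assumes "norm p < 1" "norm z < 1"
  shows "1 - cnj p * z \<noteq> 0"
proof
  assume "1 - cnj p * z = 0"
  hence "norm p * norm z = 1"
    by (metis complex_mod_cnj norm_mult norm_one right_minus_eq)
  moreover have "norm p * norm z < 1 * 1"
    using assms by (intro mult_strict_mono') auto
  ultimately show False by simp
qed

lemma disk_involution_eq_Moebius: "disk_involution p z = - Moebius_function 0 p z"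
  unfolding disk_involution_def Moebius_function_simple by (metis minus_diff_eq minus_divide_left)

lemma disk_involution_involutive:
  assumes "norm p < 1" "norm z < 1"
  shows "disk_involution p (disk_involution p z) = z"
proof -
  have nz: "1 - cnj p * z \<noteq> 0" "1 - cnj p * p \<noteq> 0"
    using one_minus_cnj_mult_nonzero assms by blast+
  have "p - (p - z) / (1 - cnj p * z) = z * (1 - cnj p * p) / (1 - cnj p * z)"
    using nz by (simp add: field_simps)
  moreover have "1 - cnj p * ((p - z) / (1 - cnj p * z)) = (1 - cnj p * p) / (1 - cnj p * z)"
    using nz by (simp add: field_simps)
  ultimately show ?thesis
    using nz by (simp add: disk_involution_def)
qed

lemma disk_chart_involution:
  assumes "norm p < 1"
  shows "disk_chart unit_disk (disk_involution p) (disk_involution p)"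
proof
  show hol: "disk_involution p holomorphic_on unit_disk"
    unfolding disk_involution_def using one_minus_cnj_mult_nonzero[OF assms]
    by (intro holomorphic_intros) auto
  show into: "disk_involution p z \<in> unit_disk" if "z \<in> unit_disk" for z
    using Moebius_function_norm_lt_1[OF assms] that by (simp add: disk_involution_eq_Moebius)
qed (use disk_involution_involutive[OF assms] in auto)

text \<open>
  The Cayley transform taking \<open>p\<close> on the unit circle to infinity.
\<close>

definition cayley :: "complex \<Rightarrow> complex \<Rightarrow> complex" where
  "cayley p z = (p + z) / (p - z)"

definition cayley_inv :: "complex \<Rightarrow> complex \<Rightarrow> complex" where
  "cayley_inv p w = p * (w - 1) / (w + 1)"

lemma disk_chart_cayley:
  assumes p: "norm p = 1"
  shows "disk_chart right_half_plane (cayley p) (cayley_inv p)"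
proof
  have p0: "p \<noteq> 0" using p by auto
  have ne: "p - z \<noteq> 0" if "z \<in> unit_disk" for z
    using that p by auto
  have ne': "w + 1 \<noteq> 0" if "w \<in> right_half_plane" for w
    using that by (auto simp: right_half_plane_def complex_eq_iff)
  show "cayley p holomorphic_on unit_disk"
    unfolding cayley_def using ne by (intro holomorphic_intros) auto
  show "cayley_inv p holomorphic_on right_half_plane"
    unfolding cayley_inv_def using ne' by (intro holomorphic_intros) auto
  show "cayley p z \<in> right_half_plane" if z: "z \<in> unit_disk" for z
  proof -
    have "Re ((p + z) * cnj (p - z)) = (norm p)\<^sup>2 - (norm z)\<^sup>2"
      unfolding cmod_power2 by (simp add: algebra_simps power2_eq_square)
    moreover have "(norm z)\<^sup>2 < 1"
      using z by (simp add: abs_square_less_1)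
    ultimately have "0 < Re ((p + z) * cnj (p - z))"
      using p by simp
    moreover have "cayley p z = (p + z) * cnj (p - z) / of_real ((norm (p - z))\<^sup>2)"
      unfolding cayley_def by (metis complex_div_cnj)
    ultimately show ?thesis
      using ne[OF z] by (simp add: right_half_plane_def Re_divide_of_real del: of_real_power)
  qed
  show "cayley_inv p w \<in> unit_disk" if w: "w \<in> right_half_plane" for w
  proof -
    have "(norm (w - 1))\<^sup>2 < (norm (w + 1))\<^sup>2"
      using w unfolding cmod_power2 right_half_plane_def
      by (simp add: algebra_simps power2_eq_square)
    hence "norm (w - 1) < norm (w + 1)"
      by (rule power2_less_imp_less) simp
    thus ?thesis
      using ne'[OF w] p by (simp add: cayley_inv_def norm_divide norm_mult)
  qed
  show "cayley_inv p (cayley p z) = z" if "z \<in> unit_disk" for z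
  proof -
    have "cayley p z - 1 = 2 * z / (p - z)" "cayley p z + 1 = 2 * p / (p - z)"
      unfolding cayley_def using ne[OF that] by (simp_all add: field_simps)
    thus ?thesis
      using ne[OF that] p0 by (simp add: cayley_inv_def)
  qed
  show "cayley p (cayley_inv p w) = w" if "w \<in> right_half_plane" for w
  proof -
    have "p + cayley_inv p w = 2 * p * w / (w + 1)" "p - cayley_inv p w = 2 * p / (w + 1)"
      unfolding cayley_inv_def using ne'[OF that] by (simp_all add: field_simps)
    thus ?thesis
      using ne'[OF that] p0 by (simp add: cayley_def)
  qed
qed

section \<open>Fractional linear maps\<close>

text \<open>
  The domain \<open>S\<close> is a parameter so that coordinate changes between the disk and the half-plane are
  covered and the composition of fractional linear maps can be formed along them.
\<close>

definition fractional_linear_on :: "complex set \<Rightarrow> (complex \<Rightarrow> complex) \<Rightarrow> bool" where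
  "fractional_linear_on S f \<longleftrightarrow> (\<exists>a b c d. a * d - b * c \<noteq> 0 \<and>
     (\<forall>z\<in>S. c * z + d \<noteq> 0 \<and> f z = (a * z + b) / (c * z + d)))"

lemma fractional_linear_onI:
  assumes "a * d - b * c \<noteq> 0" "\<And>z. z \<in> S \<Longrightarrow> c * z + d \<noteq> 0 \<and> f z = (a * z + b) / (c * z + d)"
  shows "fractional_linear_on S f"
  using assms unfolding fractional_linear_on_def by blast

lemma fractional_linear_on_compose:
  assumes "fractional_linear_on S f" "fractional_linear_on R g" "\<And>z. z \<in> S \<Longrightarrow> f z \<in> R"
  shows "fractional_linear_on S (g \<circ> f)"
proof -
  obtain a b c d where f: "a * d - b * c \<noteq> 0"
    "\<And>z. z \<in> S \<Longrightarrow> c * z + d \<noteq> 0 \<and> f z = (a * z + b) / (c * z + d)"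
    using assms(1) unfolding fractional_linear_on_def by metis
  obtain a' b' c' d' where g: "a' * d' - b' * c' \<noteq> 0"
    "\<And>z. z \<in> R \<Longrightarrow> c' * z + d' \<noteq> 0 \<and> g z = (a' * z + b') / (c' * z + d')"
    using assms(2) unfolding fractional_linear_on_def by metis
  show ?thesis
  proof (rule fractional_linear_onI[where a = "a' * a + b' * c" and b = "a' * b + b' * d"
        and c = "c' * a + d' * c" and d = "c' * b + d' * d"])
    have "(a' * a + b' * c) * (c' * b + d' * d) - (a' * b + b' * d) * (c' * a + d' * c)
        = (a * d - b * c) * (a' * d' - b' * c')"
      by algebra
    thus "(a' * a + b' * c) * (c' * b + d' * d) - (a' * b + b' * d) * (c' * a + d' * c) \<noteq> 0"
      using f g by simp
  next
    fix z assume z: "z \<in> S"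
    define q where "q = c * z + d"
    have q: "q \<noteq> 0" "f z = (a * z + b) / q"
      using f(2)[OF z] by (auto simp: q_def)
    have gz: "c' * f z + d' \<noteq> 0" "g (f z) = (a' * f z + b') / (c' * f z + d')"
      using g(2)[OF assms(3)[OF z]] by auto
    have e: "(a' * a + b' * c) * z + (a' * b + b' * d) = q * (a' * f z + b')"
        "(c' * a + d' * c) * z + (c' * b + d' * d) = q * (c' * f z + d')"
      using q(1) unfolding q(2) by (auto simp: q_def field_simps)
    show "(c' * a + d' * c) * z + (c' * b + d' * d) \<noteq> 0 \<and>
        (g \<circ> f) z = ((a' * a + b' * c) * z + (a' * b + b' * d)) /
          ((c' * a + d' * c) * z + (c' * b + d' * d))"
      unfolding e using q gz by simp
  qed
qed

lemma fractional_linear_disk_involution: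
  assumes "norm p < 1"
  shows "fractional_linear_on unit_disk (disk_involution p)"
proof (rule fractional_linear_onI[where a = "-1" and b = p and c = "- cnj p" and d = 1])
  show "- 1 * 1 - p * - cnj p \<noteq> 0"
    using one_minus_cnj_mult_nonzero[OF assms assms] by (simp add: mult.commute)
qed (use one_minus_cnj_mult_nonzero[OF assms] in \<open>auto simp: disk_involution_def\<close>)

lemma fractional_linear_cayley:
  assumes "norm p = 1"
  shows "fractional_linear_on unit_disk (cayley p)"
  by (rule fractional_linear_onI[where a = 1 and b = p and c = "-1" and d = p])
    (use assms in \<open>auto simp: cayley_def add.commute dest: arg_cong[where f = norm]\<close>)

lemma fractional_linear_cayley_inv:
  assumes "norm p = 1"
  shows "fractional_linear_on right_half_plane (cayley_inv p)"
  by (rule fractional_linear_onI[where a = p and b = "- p" and c = 1 and d = 1])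
    (use assms in \<open>auto simp: cayley_inv_def algebra_simps right_half_plane_def
      dest: arg_cong[where f = norm] arg_cong[where f = Re]\<close>)

section \<open>Automorphisms of the disk fixing the origin\<close>

text \<open>
  The Schwarz lemma applied to \<open>f\<close> and to its inverse gives \<open>\<bar>f z\<bar> = \<bar>z\<bar>\<close>, the case of equality.
\<close>

lemma disk_automorphism_fixing_zero_is_rotation:
  assumes hol: "f holomorphic_on unit_disk" and bij: "bij_betw f unit_disk unit_disk"
    and zero: "f 0 = 0"
  obtains l where "norm l = 1" "\<And>z. z \<in> unit_disk \<Longrightarrow> f z = l * z"
proof -
  have inj: "inj_on f unit_disk" and img: "f ` unit_disk = unit_disk"
    using bij by (auto simp: bij_betw_def)
  obtain g where g: "g holomorphic_on f ` unit_disk" "\<And>z. z \<in> unit_disk \<Longrightarrow> g (f z) = z"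
    using holomorphic_has_inverse[OF hol open_ball inj] by metis
  have gf: "norm (f z) < 1" if "norm z < 1" for z
    using img that by auto
  have gd: "norm (g w) < 1" if "norm w < 1" for w
  proof -
    obtain z where "z \<in> unit_disk" "w = f z"
      using img \<open>norm w < 1\<close> by (metis imageE mem_ball_0)
    thus ?thesis using g(2) by auto
  qed
  have g0: "g 0 = 0"
    using g(2)[of 0] zero by simp
  have "norm (f z) = norm z" if z: "norm z < 1" for z
  proof (rule antisym)
    show "norm (f z) \<le> norm z"
      using Schwarz_Lemma(1)[OF hol zero gf z] .
    show "norm z \<le> norm (f z)"
      using Schwarz_Lemma(1)[where f = g and \<xi> = "f z"] g0 gd gf[OF z] g z img by auto
  qed
  hence "\<exists>z. norm z < 1 \<and> z \<noteq> 0 \<and> norm (f z) = norm z"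
    by (intro exI[of _ "1/2"]) (auto simp: norm_divide)
  then obtain l where "\<forall>z. norm z < 1 \<longrightarrow> f z = l * z" "norm l = 1"
    using Schwarz_Lemma(3)[OF hol zero gf, of 0] by auto
  thus ?thesis using that by auto
qed

section \<open>Semigroups are determined by their values along one sequence of times\<close>

lemma disk_semigroup_self_map:
  assumes "disk_semigroup g" "0 \<le> t"
  shows "self_map (g t)"
  using assms by (auto simp: disk_semigroup_def)

lemma disk_semigroup_add:
  assumes "disk_semigroup g" "0 \<le> s" "0 \<le> t" "z \<in> unit_disk"
  shows "g s (g t z) = g (s + t) z"
  using assms unfolding disk_semigroup_def eq_on_disk_def by fastforce

lemma self_map_in_disk:
  assumes "self_map f" "z \<in> unit_disk"
  shows "f z \<in> unit_disk"
  using assms unfolding self_map_def by blast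

lemma funpow_maps_to:
  assumes "\<And>x. x \<in> S \<Longrightarrow> f x \<in> S" "x \<in> S"
  shows "(f ^^ n) x \<in> S"
  by (induction n) (use assms in auto)

lemma (in disk_chart) push_forward_funpow:
  assumes f: "self_map f" and w: "w \<in> U"
  shows "((k \<circ> f \<circ> k') ^^ n) w = k ((f ^^ n) (k' w))"
proof (induction n)
  case 0
  show ?case using right_inv[OF w] by simp
next
  case (Suc n)
  have "(f ^^ n) (k' w) \<in> unit_disk"
    using funpow_maps_to[OF self_map_in_disk[OF f] inv_maps_to[OF w]] .
  thus ?case
    using Suc left_inv by simp
qed

lemma (in disk_chart) eq_on_disk_if_push_forward_eq:
  assumes "self_map f" "self_map g" "\<And>w. w \<in> U \<Longrightarrow> (k \<circ> f \<circ> k') w = (k \<circ> g \<circ> k') w"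
  shows "eq_on_disk f g"
  unfolding eq_on_disk_def
proof
  fix z assume z: "z \<in> unit_disk"
  from assms(3)[OF maps_to[OF z]] have "k (f z) = k (g z)"
    using left_inv[OF z] by simp
  thus "f z = g z"
    using left_inv self_map_in_disk[OF assms(1) z] self_map_in_disk[OF assms(2) z] by metis
qed

lemma disk_semigroup_funpow:
  assumes g: "disk_semigroup g" and t: "0 \<le> t" and z: "z \<in> unit_disk"
  shows "(g t ^^ n) z = g (of_nat n * t) z"
proof (induction n)
  case 0
  show ?case
    using g z by (simp add: disk_semigroup_def eq_on_disk_def)
next
  case (Suc n)
  thus ?case
    using disk_semigroup_add[OF g t, of "of_nat n * t" z] t z by (simp add: algebra_simps)
qed

lemma disk_semigroup_continuous_on:
  assumes g: "disk_semigroup g" and z: "z \<in> unit_disk"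
  shows "continuous_on {0..} (\<lambda>t. g t z)"
  unfolding continuous_on_def
proof
  fix t :: real assume t: "t \<in> {0..}"
  have "\<forall>K. compact K \<and> K \<subseteq> unit_disk \<longrightarrow> uniform_limit K g (g t) (at t within {0..})"
    using g t unfolding disk_semigroup_def by auto
  from this[rule_format, of "{z}"] z show "((\<lambda>t. g t z) \<longlongrightarrow> g t z) (at t within {0..})"
    by simp
qed

text \<open>
  Multiples of a vanishing step approximate any \<open>t \<ge> 0\<close>. This supplies both the density argument
  for semigroups and the passage from dyadic to real exponents.
\<close>

lemma floor_multiple_tendsto:
  fixes f :: "nat \<Rightarrow> real"
  assumes "f \<longlonglongrightarrow> 0" "\<And>n. f n > 0" "t \<ge> 0"
  shows "(\<lambda>n. of_nat (nat \<lfloor>t / f n\<rfloor>) * f n) \<longlonglongrightarrow> t"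
proof (rule tendsto_sandwich)
  show "\<forall>\<^sub>F n in sequentially. t - f n \<le> of_nat (nat \<lfloor>t / f n\<rfloor>) * f n"
  proof (intro always_eventually allI)
    fix n
    have "t / f n \<le> of_int \<lfloor>t / f n\<rfloor> + 1"
      by linarith
    also have "of_int \<lfloor>t / f n\<rfloor> = real (nat \<lfloor>t / f n\<rfloor>)"
      using assms(2)[of n] assms(3) by simp
    finally show "t - f n \<le> of_nat (nat \<lfloor>t / f n\<rfloor>) * f n"
      using assms(2)[of n] by (simp add: field_simps)
  qed
  show "\<forall>\<^sub>F n in sequentially. of_nat (nat \<lfloor>t / f n\<rfloor>) * f n \<le> t"
  proof (intro always_eventually allI)
    fix n
    have "real (nat \<lfloor>t / f n\<rfloor>) = of_int \<lfloor>t / f n\<rfloor>"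
      using assms(2)[of n] assms(3) by simp
    also have "\<dots> \<le> t / f n"
      by linarith
    finally show "of_nat (nat \<lfloor>t / f n\<rfloor>) * f n \<le> t"
      using assms(2)[of n] by (simp add: field_simps)
  qed
  show "(\<lambda>n. t - f n) \<longlonglongrightarrow> t"
    using tendsto_diff[OF tendsto_const[of t] assms(1)] by simp
qed simp

text \<open>
  Agreement at the times \<open>s / n\<close> propagates to their multiples by the semigroup law, and these are
  dense in \<open>[0, \<infinity>)\<close>.
\<close>

lemma eq_semigroup_if_roots_eq:
  assumes g: "disk_semigroup g" and h: "disk_semigroup h" and s: "0 < s"
    and eq: "\<And>n. 1 \<le> n \<Longrightarrow> eq_on_disk (g (s / of_nat n)) (h (s / of_nat n))"
  shows "eq_semigroup g h"
  unfolding eq_semigroup_def eq_on_disk_def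
proof (intro allI impI ballI)
  fix t :: real and z assume t: "0 \<le> t" and z: "z \<in> unit_disk"
  define f where "f n = s / of_nat (Suc n)" for n
  have f: "f n > 0" for n
    using s by (simp add: f_def)
  have f0: "f \<longlonglongrightarrow> 0"
    using tendsto_mult_right_zero[OF LIMSEQ_inverse_real_of_nat, of s]
    by (simp add: f_def[abs_def] divide_inverse)
  define u where "u n = of_nat (nat \<lfloor>t / f n\<rfloor>) * f n" for n
  have u: "u \<longlonglongrightarrow> t"
    using floor_multiple_tendsto[OF f0 f t] by (simp add: u_def[abs_def])
  have u0: "u n \<ge> 0" for n
    using f[of n] by (simp add: u_def)
  have "(g (f n) ^^ m) z = (h (f n) ^^ m) z" for m n
  proof (induction m)
    case (Suc m)
    have "(h (f n) ^^ m) z \<in> unit_disk"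
      using funpow_maps_to[OF self_map_in_disk[OF disk_semigroup_self_map[OF h]]] f[of n] z
      by auto
    thus ?case
      using Suc eq[of "Suc n"] by (simp add: f_def eq_on_disk_def)
  qed simp
  hence "g (u n) z = h (u n) z" for n
    unfolding u_def
    by (metis disk_semigroup_funpow[OF g less_imp_le[OF f] z]
        disk_semigroup_funpow[OF h less_imp_le[OF f] z])
  moreover have "(\<lambda>n. g (u n) z) \<longlonglongrightarrow> g t z" "(\<lambda>n. h (u n) z) \<longlonglongrightarrow> h t z"
    using continuous_on_tendsto_compose[OF disk_semigroup_continuous_on[OF g z] u]
      continuous_on_tendsto_compose[OF disk_semigroup_continuous_on[OF h z] u] t u0
    by (auto intro!: always_eventually)
  ultimately show "g t z = h t z"
    using LIMSEQ_unique by force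
qed

section \<open>Affine maps and automorphisms of the half-plane\<close>

definition affine_map :: "real \<Rightarrow> complex \<Rightarrow> complex \<Rightarrow> complex" where
  "affine_map a b w = of_real a * w + b"

lemma affine_map_funpow:
  "(affine_map a b ^^ n) w = of_real (a ^ n) * w + b * of_real (\<Sum>k<n. a ^ k)"
proof (induction n)
  case (Suc n)
  have "of_real a * (\<Sum>k<n. of_real a ^ k) + 1 = (\<Sum>k<Suc n. of_real a ^ k :: complex)"
    by (subst sum.lessThan_Suc_shift) (simp add: sum_distrib_left)
  hence "of_real a * (b * (\<Sum>k<n. of_real a ^ k)) + b = b * (\<Sum>k<Suc n. of_real a ^ k)"
    by (metis distrib_left mult.left_commute mult.right_neutral)
  with Suc show ?case
    by (simp add: affine_map_def algebra_simps del: sum.lessThan_Suc)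
qed simp

lemma affine_map_in_half_plane:
  assumes "0 < a" "0 \<le> Re b" "w \<in> right_half_plane"
  shows "affine_map a b w \<in> right_half_plane"
  using assms by (simp add: affine_map_def right_half_plane_def add_pos_nonneg)

text \<open>
  The multiplier of an iterate is \<open>a ^ n\<close>, which determines \<open>a > 0\<close>; its constant term is \<open>b\<close> times
  \<open>1 + a + \<dots> + a ^ (n - 1)\<close>, a positive number. With a complex multiplier \<open>a\<close> both steps would fail.
\<close>

lemma affine_map_funpow_root_unique:
  assumes pos: "0 < a" "0 < a'" and n: "1 \<le> n"
    and eq: "\<And>w. w \<in> right_half_plane \<Longrightarrow> (affine_map a b ^^ n) w = (affine_map a' b' ^^ n) w"
  shows "a = a' \<and> b = b'"
proof -
  define S S' :: complex where "S = of_real (\<Sum>k<n. a ^ k)" and "S' = of_real (\<Sum>k<n. a' ^ k)"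
  have 1: "of_real (a ^ n) + b * S = of_real (a' ^ n) + b' * S'"
    using eq[of 1] by (simp add: affine_map_funpow right_half_plane_def S_def S'_def)
  have 2: "of_real (a ^ n) * 2 + b * S = of_real (a' ^ n) * 2 + b' * S'"
    using eq[of 2] by (simp add: affine_map_funpow right_half_plane_def S_def S'_def)
  from 1 2 have "of_real (a ^ n) = (of_real (a' ^ n) :: complex)"
    by algebra
  hence "a ^ n = a' ^ n"
    using of_real_eq_iff by blast
  hence a: "a = a'"
    using pos n by (intro power_eq_imp_eq_base[of a n a']) auto
  have "0 < (\<Sum>k<n. a ^ k)"
    using pos n by (intro sum_pos) (auto simp: lessThan_empty_iff)
  hence "S \<noteq> 0"
    unfolding S_def by (metis of_real_eq_0_iff less_irrefl)
  thus ?thesis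
    using 1 a by (simp add: S_def S'_def)
qed

lemma fractional_linear_at_infinity:
  fixes A B C D :: complex
  assumes "C \<noteq> 0"
  shows "((\<lambda>u. (A * u + B) / (C * u + D)) \<longlongrightarrow> A / C) at_infinity"
proof -
  have "((\<lambda>u. (A + B / u) / (C + D / u)) \<longlongrightarrow> (A + 0) / (C + 0)) at_infinity"
    using assms by (intro tendsto_intros tendsto_divide_0[OF tendsto_const filterlim_ident]) auto
  moreover have "\<forall>\<^sub>F u in at_infinity. (A + B / u) / (C + D / u) = (A * u + B) / (C * u + D)"
    using eventually_not_equal_at_infinity[of 0]
  proof eventually_elim
    case (elim u)
    have "A + B / u = (A * u + B) / u" "C + D / u = (C * u + D) / u"
      using elim by (simp_all add: field_simps)
    thus ?case
      using elim by simp
  qed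
  ultimately show ?thesis
    using Lim_transform_eventually by fastforce
qed

text \<open>
  After composing \<open>G\<close> with the affine automorphism taking \<open>G 1 = x + \<i> y\<close> back to \<open>1\<close>, the Cayley
  transform yields a disk automorphism fixing \<open>0\<close>, that is, the rotation by \<open>l\<close>. The formula exhibits
  \<open>l = 1\<close> as the condition for \<open>G\<close> to fix infinity.
\<close>

lemma half_plane_automorphism_form:
  assumes hol: "G holomorphic_on right_half_plane"
    and bij: "bij_betw G right_half_plane right_half_plane"
  obtains x y :: real and l :: complex where "0 < x" "norm l = 1"
    "\<And>u. u \<in> right_half_plane \<Longrightarrow>
       G u = ((of_real x * (1 + l) + \<i> * of_real y * (1 - l)) * u
            + (of_real x * (1 - l) + \<i> * of_real y * (1 + l))) / ((1 - l) * u + (1 + l))"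
proof -
  interpret disk_chart right_half_plane "cayley 1" "cayley_inv 1"
    by (rule disk_chart_cayley) simp
  have one: "1 \<in> right_half_plane"
    by (simp add: right_half_plane_def)
  define x where "x = Re (G 1)"
  define y where "y = Im (G 1)"
  have G1: "G 1 = of_real x + \<i> * of_real y"
    by (simp add: x_def y_def complex_eq_iff)
  have x: "0 < x"
    using bij_betwE[OF bij] one by (auto simp: x_def right_half_plane_def)
  define A where "A w = (w - \<i> * of_real y) / of_real x" for w
  have bijA: "bij_betw A right_half_plane right_half_plane"
    by (rule bij_betw_byWitness[where f' = "\<lambda>w. of_real x * w + \<i> * of_real y"])
      (use x in \<open>auto simp: A_def right_half_plane_def Re_divide_of_real\<close>)
  define f where "f = cayley_inv 1 \<circ> (A \<circ> G) \<circ> cayley 1"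
  have bijc: "bij_betw (cayley 1) unit_disk right_half_plane"
    by (rule bij_betw_byWitness[where f' = "cayley_inv 1"])
      (use maps_to inv_maps_to left_inv right_inv in auto)
  have bijc': "bij_betw (cayley_inv 1) right_half_plane unit_disk"
    by (rule bij_betw_byWitness[where f' = "cayley 1"])
      (use maps_to inv_maps_to left_inv right_inv in auto)
  have bijf: "bij_betw f unit_disk unit_disk"
    unfolding f_def by (intro bij_betw_trans[OF bijc] bij_betw_trans[OF _ bijc']
        bij_betw_trans[OF bij bijA])
  have "A \<circ> G holomorphic_on right_half_plane"
    unfolding A_def comp_def using x by (intro holomorphic_intros hol) auto
  hence "f holomorphic_on unit_disk"
    using self_map_pull_back[of "A \<circ> G"] bij_betwE[OF bij] bij_betwE[OF bijA]
    by (auto simp: f_def self_map_def)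
  moreover have "f 0 = 0"
    using x by (simp add: f_def cayley_def cayley_inv_def A_def G1)
  ultimately obtain l where l: "norm l = 1" "\<And>z. z \<in> unit_disk \<Longrightarrow> f z = l * z"
    using disk_automorphism_fixing_zero_is_rotation bijf by metis
  show ?thesis
  proof (rule that[OF x l(1)])
    fix u assume u: "u \<in> right_half_plane"
    define z where "z = cayley_inv 1 u"
    have z: "z \<in> unit_disk" "cayley 1 z = u"
      using u inv_maps_to right_inv by (auto simp: z_def)
    have AG: "A (G u) \<in> right_half_plane"
      using u bij_betwE[OF bij] bij_betwE[OF bijA] by auto
    have u1: "u + 1 \<noteq> 0"
      using u by (auto simp: right_half_plane_def complex_eq_iff)
    have lz: "l * z \<in> unit_disk"
      using z(1) l(1) by (simp add: norm_mult)
    hence ne: "1 - l * z \<noteq> 0"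
      by auto
    have "cayley_inv 1 (A (G u)) = l * z"
      using l(2)[OF z(1)] z(2) by (simp add: f_def)
    hence "A (G u) = cayley 1 (l * z)"
      using right_inv[OF AG] by simp
    hence "A (G u) = (1 + l * z) / (1 - l * z)"
      by (simp add: cayley_def)
    moreover have "G u = of_real x * A (G u) + \<i> * of_real y"
      using x by (simp add: A_def)
    ultimately have Gu: "G u = of_real x * ((1 + l * z) / (1 - l * z)) + \<i> * of_real y"
      by simp
    have "1 + l * z = ((1 + l) * u + (1 - l)) / (u + 1)" "1 - l * z = ((1 - l) * u + (1 + l)) / (u + 1)"
      using u1 by (simp_all add: z_def cayley_inv_def field_simps)
    hence ratio: "(1 + l * z) / (1 - l * z) = ((1 + l) * u + (1 - l)) / ((1 - l) * u + (1 + l))"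
      and den: "(1 - l) * u + (1 + l) \<noteq> 0"
      using u1 ne by auto
    show "G u = ((of_real x * (1 + l) + \<i> * of_real y * (1 - l)) * u
            + (of_real x * (1 - l) + \<i> * of_real y * (1 + l))) / ((1 - l) * u + (1 + l))"
      unfolding Gu ratio times_divide_eq_right divide_add_eq_iff[OF den]
      by (simp add: algebra_simps)
  qed
qed

text \<open>
  Orbits of \<open>T\<close> tend to infinity, and \<open>G\<close> maps the orbit of \<open>1\<close> to the orbit of \<open>G 1\<close>. Were \<open>l \<noteq> 1\<close>,
  then \<open>G\<close> would have a finite limit at infinity, so the latter orbit would converge.
\<close>

lemma half_plane_automorphism_commuting_is_affine:
  assumes hol: "G holomorphic_on right_half_plane"
    and bij: "bij_betw G right_half_plane right_half_plane"
    and T: "\<And>w. w \<in> right_half_plane \<Longrightarrow> T w \<in> right_half_plane"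
    and comm: "\<And>w. w \<in> right_half_plane \<Longrightarrow> G (T w) = T (G w)"
    and escape: "\<And>w. w \<in> right_half_plane \<Longrightarrow> filterlim (\<lambda>n. (T ^^ n) w) at_infinity sequentially"
  shows "\<exists>a>0. \<exists>b. \<forall>w\<in>right_half_plane. G w = affine_map a b w"
proof -
  obtain x y :: real and l where x: "0 < x" and
    form: "\<And>u. u \<in> right_half_plane \<Longrightarrow>
       G u = ((of_real x * (1 + l) + \<i> * of_real y * (1 - l)) * u
            + (of_real x * (1 - l) + \<i> * of_real y * (1 + l))) / ((1 - l) * u + (1 + l))"
    using half_plane_automorphism_form[OF hol bij] by metis
  have one: "1 \<in> right_half_plane" "G 1 \<in> right_half_plane"
    using bij_betwE[OF bij] by (auto simp: right_half_plane_def)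
  have "l = 1"
  proof (rule ccontr)
    assume "l \<noteq> 1"
    hence "(1 - l) \<noteq> 0" by simp
    note lim = filterlim_compose[OF fractional_linear_at_infinity[OF this] escape[OF one(1)]]
    have Tn: "(T ^^ n) 1 \<in> right_half_plane" for n
      using funpow_maps_to[OF T one(1)] .
    have iter: "G ((T ^^ n) 1) = (T ^^ n) (G 1)" for n
      by (induction n) (use comm Tn in auto)
    have "\<exists>c. (\<lambda>n. (T ^^ n) (G 1)) \<longlonglongrightarrow> c"
      unfolding iter[symmetric] form[OF Tn] using lim by blast
    thus False
      using escape[OF one(2)] not_tendsto_and_filterlim_at_infinity[OF sequentially_bot] by blast
  qed
  hence "G w = affine_map x (\<i> * of_real y) w" if "w \<in> right_half_plane" for w
    using form[OF that] by (simp add: affine_map_def add_divide_distrib)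
  thus ?thesis
    using x by blast
qed

section \<open>Extending maps that commute with an affine map\<close>

text \<open>
  A self-map \<open>F\<close> of the half-plane commuting with an affine self-map \<open>T\<close>. The map \<open>T\<close> is invertible on
  the whole plane, so \<open>T\<^sup>-\<^sup>k \<circ> F \<circ> T\<^sup>k\<close> makes sense wherever \<open>T\<^sup>k\<close> has already reached the half-plane,
  and as \<open>F\<close> commutes with \<open>T\<close> its value is the same for all such \<open>k\<close>.
\<close>

locale commuting_affine =
  fixes T :: "complex \<Rightarrow> complex" and \<alpha> :: real and \<beta> :: complex and F :: "complex \<Rightarrow> complex"
  defines "T \<equiv> affine_map \<alpha> \<beta>"
  assumes \<alpha>: "0 < \<alpha>" and \<beta>: "0 \<le> Re \<beta>"
    and hol: "F holomorphic_on right_half_plane"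
    and into: "\<And>w. w \<in> right_half_plane \<Longrightarrow> F w \<in> right_half_plane"
    and comm: "\<And>w. w \<in> right_half_plane \<Longrightarrow> F (T w) = T (F w)"
begin

definition basin :: "complex set" where
  "basin = {w. \<exists>k. (T ^^ k) w \<in> right_half_plane}"

definition T_inv :: "complex \<Rightarrow> complex" where
  "T_inv w = (w - \<beta>) / of_real \<alpha>"

definition extension :: "complex \<Rightarrow> complex" where
  "extension w = (let k = LEAST k. (T ^^ k) w \<in> right_half_plane in (T_inv ^^ k) (F ((T ^^ k) w)))"

lemma T_inv_T [simp]: "T_inv (T w) = w" and T_T_inv [simp]: "T (T_inv w) = w"
  using \<alpha> by (simp_all add: T_def T_inv_def affine_map_def)

lemma T_inv_funpow_T_funpow [simp]: "(T_inv ^^ k) ((T ^^ k) w) = w"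
proof (induction k)
  case (Suc k)
  thus ?case
    by (subst funpow_Suc_right) simp
qed simp

lemma T_funpow_T_inv_funpow [simp]: "(T ^^ k) ((T_inv ^^ k) w) = w"
proof (induction k)
  case (Suc k)
  thus ?case
    by (subst funpow_Suc_right) simp
qed simp

lemma T_into: "w \<in> right_half_plane \<Longrightarrow> T w \<in> right_half_plane"
  unfolding T_def using affine_map_in_half_plane \<alpha> \<beta> by blast

lemma T_funpow_into: "w \<in> right_half_plane \<Longrightarrow> (T ^^ k) w \<in> right_half_plane"
  using funpow_maps_to[OF T_into] .

lemma comm_funpow: "w \<in> right_half_plane \<Longrightarrow> F ((T ^^ k) w) = (T ^^ k) (F w)"
  by (induction k) (use comm T_funpow_into in auto)

lemma T_funpow_holomorphic: "(T ^^ k) holomorphic_on S"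
  unfolding T_def affine_map_funpow[abs_def] by (intro holomorphic_intros)

lemma T_inv_funpow_holomorphic: "(T_inv ^^ k) holomorphic_on S"
proof (induction k)
  case 0
  thus ?case by (simp add: id_def)
next
  case (Suc k)
  have "T_inv holomorphic_on UNIV"
    unfolding T_inv_def using \<alpha> by (intro holomorphic_intros) auto
  from holomorphic_on_compose_gen[OF Suc this] show ?case
    by (simp only: funpow.simps(2) subset_UNIV simp_thms)
qed

lemma extension_eq:
  assumes "(T ^^ m) w \<in> right_half_plane"
  shows "extension w = (T_inv ^^ m) (F ((T ^^ m) w))"
proof -
  define k where "k = (LEAST k. (T ^^ k) w \<in> right_half_plane)"
  have k: "(T ^^ k) w \<in> right_half_plane" "k \<le> m"
    unfolding k_def using assms by (rule LeastI, rule Least_le)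
  then obtain j where j: "m = k + j"
    using le_Suc_ex by blast
  have "F ((T ^^ m) w) = (T ^^ j) (F ((T ^^ k) w))"
    unfolding j add.commute[of k j] funpow_add comp_def using comm_funpow[OF k(1)] .
  hence "(T_inv ^^ m) (F ((T ^^ m) w)) = (T_inv ^^ k) (F ((T ^^ k) w))"
    unfolding j funpow_add by simp
  thus ?thesis
    unfolding extension_def Let_def k_def[symmetric] by simp
qed

lemma extension_eq_F: "w \<in> right_half_plane \<Longrightarrow> extension w = F w"
  using extension_eq[of 0 w] by simp

lemma T_funpow_extension:
  assumes "(T ^^ m) w \<in> right_half_plane"
  shows "(T ^^ m) (extension w) = F ((T ^^ m) w)"
  using extension_eq[OF assms] by simp

lemma in_basin_E:
  assumes "w \<in> basin"
  obtains k where "(T ^^ k) w \<in> right_half_plane"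
  using assms unfolding basin_def by blast

lemma in_basinI: "(T ^^ k) w \<in> right_half_plane \<Longrightarrow> w \<in> basin"
  unfolding basin_def by blast

lemma extension_in_basin:
  assumes "w \<in> basin"
  shows "extension w \<in> basin"
proof -
  obtain k where k: "(T ^^ k) w \<in> right_half_plane"
    using assms by (rule in_basin_E)
  show ?thesis
    by (rule in_basinI[of k]) (simp only: T_funpow_extension[OF k] into[OF k])
qed

lemma T_in_basin:
  assumes "w \<in> basin"
  shows "T w \<in> basin"
proof -
  obtain k where k: "(T ^^ k) w \<in> right_half_plane"
    using assms by (rule in_basin_E)
  show ?thesis
    by (rule in_basinI[of k]) (simp only: T_into[OF k] funpow_swap1[symmetric])
qed

lemma T_inv_in_basin: "w \<in> basin \<Longrightarrow> T_inv w \<in> basin"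
proof -
  assume "w \<in> basin"
  then obtain k where "(T ^^ k) w \<in> right_half_plane"
    by (rule in_basin_E)
  hence "(T ^^ Suc k) (T_inv w) \<in> right_half_plane"
    by (simp only: funpow_Suc_right comp_def T_T_inv)
  thus ?thesis
    by (rule in_basinI)
qed

lemma extension_T: "w \<in> basin \<Longrightarrow> extension (T w) = T (extension w)"
proof -
  assume "w \<in> basin"
  then obtain k where k: "(T ^^ k) w \<in> right_half_plane"
    by (rule in_basin_E)
  have "(T ^^ k) (T w) \<in> right_half_plane"
    using T_into[OF k] by (simp only: funpow_swap1)
  hence "(T ^^ k) (extension (T w)) = F ((T ^^ k) (T w))"
    by (rule T_funpow_extension)
  also have "\<dots> = F (T ((T ^^ k) w))"
    by (simp only: funpow_swap1)
  also have "\<dots> = T ((T ^^ k) (extension w))"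
    by (simp only: comm[OF k] T_funpow_extension[OF k])
  also have "\<dots> = (T ^^ k) (T (extension w))"
    by (rule funpow_swap1)
  finally have "(T_inv ^^ k) ((T ^^ k) (extension (T w))) = (T_inv ^^ k) ((T ^^ k) (T (extension w)))"
    by (rule arg_cong)
  thus ?thesis
    by (simp only: T_inv_funpow_T_funpow)
qed

lemma extension_holomorphic: "extension holomorphic_on basin"
proof -
  define W where "W k = (T ^^ k) -` right_half_plane" for k
  have basin: "basin = (\<Union>k. W k)"
    by (auto simp: basin_def W_def)
  have openW: "open (W k)" for k
    unfolding W_def using T_funpow_holomorphic[of k UNIV] open_right_half_plane
    by (intro open_vimage) (auto dest: holomorphic_on_imp_continuous_on)
  have "extension holomorphic_on W k" for k
  proof (rule holomorphic_transform)
    show "(T_inv ^^ k) \<circ> (F \<circ> (T ^^ k)) holomorphic_on W k"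
      by (intro holomorphic_on_compose_gen[OF holomorphic_on_compose_gen[OF T_funpow_holomorphic hol]
            T_inv_funpow_holomorphic[of _ UNIV]]) (auto simp: W_def)
  qed (simp add: extension_eq W_def)
  thus ?thesis
    unfolding basin by (intro holomorphic_on_UN_open openW) auto
qed

text \<open>
  \<open>T\<close> is bijective on the basin although it need not be onto on the half-plane; a map with an iterate
  equal to a bijection is itself bijective.
\<close>

lemma extension_bij:
  assumes n: "1 \<le> n" and root: "\<And>w. w \<in> right_half_plane \<Longrightarrow> (F ^^ n) w = T w"
  shows "bij_betw extension basin basin"
proof -
  have root': "(extension ^^ n) w = T w" if w: "w \<in> basin" for w
  proof -
    obtain k where k: "(T ^^ k) w \<in> right_half_plane"
      using w by (rule in_basin_E)
    have "(T ^^ k) ((extension ^^ j) w) = (F ^^ j) ((T ^^ k) w) \<and> (F ^^ j) ((T ^^ k) w) \<in> right_half_plane"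
      for j
    proof (induction j)
      case (Suc j)
      hence "(T ^^ k) (extension ((extension ^^ j) w)) = F ((T ^^ k) ((extension ^^ j) w))"
        using T_funpow_extension by simp
      with Suc into show ?case
        by simp
    qed (simp add: k)
    hence "(T ^^ k) ((extension ^^ n) w) = T ((T ^^ k) w)"
      using root[OF k] by simp
    also have "\<dots> = (T ^^ k) (T w)"
      by (rule funpow_swap1)
    finally have "(T_inv ^^ k) ((T ^^ k) ((extension ^^ n) w)) = (T_inv ^^ k) ((T ^^ k) (T w))"
      by (rule arg_cong)
    thus ?thesis
      by (simp only: T_inv_funpow_T_funpow)
  qed
  obtain m where m: "n = Suc m"
    using n by (cases n) auto
  have in_basin: "(extension ^^ m) w \<in> basin" if "w \<in> basin" for w
    using funpow_maps_to[OF extension_in_basin that] .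
  show ?thesis
  proof (rule bij_betw_byWitness[where f' = "T_inv \<circ> (extension ^^ m)"])
    show "\<forall>w\<in>basin. (T_inv \<circ> extension ^^ m) (extension w) = w"
      using root' unfolding m funpow_Suc_right by simp
    have "extension (T_inv w) = T_inv (extension w)" if "w \<in> basin" for w
      using arg_cong[OF extension_T[OF T_inv_in_basin[OF that]], of T_inv] by simp
    thus "\<forall>w\<in>basin. extension ((T_inv \<circ> extension ^^ m) w) = w"
      using root' in_basin unfolding m by simp
  qed (use extension_in_basin in_basin T_inv_in_basin in auto)
qed

end

section \<open>Iterative roots of affine maps\<close>

text \<open>
  The displacement \<open>G w - w\<close> has period \<open>\<beta>\<close>, so its real part need only be bounded below on a strip
  of points \<open>v\<close> with \<open>0 < Re v \<le> 2 Re \<beta>\<close>, where \<open>Re (G v) > 0\<close>. An entire function with real part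
  bounded below is constant.
\<close>

lemma entire_commuting_translation_is_translation:
  assumes hol: "G holomorphic_on UNIV" and \<beta>: "0 < Re \<beta>"
    and per: "\<And>w. G (w + \<beta>) = G w + \<beta>"
    and into: "\<And>w. w \<in> right_half_plane \<Longrightarrow> G w \<in> right_half_plane"
  obtains b where "\<And>w. G w = w + b"
proof -
  define P where "P w = G w - w" for w
  have add: "P (w + of_nat n * \<beta>) = P w" for w n
  proof (induction n)
    case (Suc n)
    thus ?case
      using per[of "w + of_nat n * \<beta>"] by (simp add: P_def algebra_simps)
  qed (simp add: P_def)
  have P_int: "P (w + of_int k * \<beta>) = P w" for w k
  proof (cases "0 \<le> k")
    case True
    thus ?thesis
      using add[of w "nat k"] by simp
  next
    case False
    thus ?thesis
      using add[of "w + of_int k * \<beta>" "nat (- k)"] by (simp add: algebra_simps)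
  qed
  have bound: "- 2 * Re \<beta> \<le> Re (P w)" for w
  proof -
    \<comment> \<open>The extra period in \<open>v\<close> keeps \<open>Re v\<close> strictly positive when \<open>Re w\<close> is a multiple of \<open>Re \<beta>\<close>.\<close>
    define k where "k = \<lceil>- Re w / Re \<beta>\<rceil>"
    define v where "v = w + of_int (k + 1) * \<beta>"
    have "- Re w / Re \<beta> \<le> of_int k" "of_int k < - Re w / Re \<beta> + 1"
      unfolding k_def by linarith+
    hence "- Re w \<le> of_int k * Re \<beta>" "of_int k * Re \<beta> < - Re w + Re \<beta>"
      using \<beta> by (simp_all add: field_simps)
    hence v: "0 < Re v" "Re v \<le> 2 * Re \<beta>"
      using \<beta> by (simp_all add: v_def algebra_simps)
    hence "0 < Re (G v)"
      using into[of v] by (simp add: right_half_plane_def)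
    moreover have "P w = G v - v"
      using P_int[of w "k + 1"] by (simp add: P_def v_def)
    ultimately show ?thesis
      using v by simp
  qed
  \<comment> \<open>Shifting \<open>P\<close> so that its real part is at least 1 makes its reciprocal bounded by 1.\<close>
  define Q where "Q w = 1 / (P w + of_real (2 * Re \<beta>) + 1)" for w
  have re: "1 \<le> Re (P w + of_real (2 * Re \<beta>) + 1)" for w
    using bound[of w] by simp
  have ge: "1 \<le> norm (P w + of_real (2 * Re \<beta>) + 1)" for w
    using order_trans[OF re complex_Re_le_cmod] .
  have ne: "P w + of_real (2 * Re \<beta>) + 1 \<noteq> 0" for w
    using ge[of w] by (metis norm_zero not_one_le_zero)
  have "Q holomorphic_on UNIV"
    unfolding Q_def P_def using ne by (intro holomorphic_intros hol) (auto simp: P_def)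
  moreover have "bounded (range Q)"
  proof (rule boundedI)
    fix q assume "q \<in> range Q"
    then obtain w where "q = Q w" by blast
    thus "norm q \<le> 1"
      using order_less_le_trans[OF zero_less_one ge[of w]] ge[of w]
      by (simp add: Q_def norm_divide divide_le_eq_1_pos del: of_real_mult)
  qed
  ultimately have "Q constant_on UNIV"
    by (rule Liouville_theorem)
  then obtain c where Q: "Q w = c" for w
    by (auto simp: constant_on_def)
  have "P w + of_real (2 * Re \<beta>) + 1 = 1 / c" for w
    unfolding Q[of w, symmetric] Q_def by simp
  hence "P w = 1 / c - of_real (2 * Re \<beta>) - 1" for w
    by (simp add: algebra_simps)
  hence "G w = w + (1 / c - of_real (2 * Re \<beta>) - 1)" for w
    unfolding P_def by (metis diff_add_cancel add.commute)
  thus ?thesis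
    using that by blast
qed

text \<open>
  The basin of \<open>T w = \<alpha> w + \<beta>\<close> is the whole plane if \<open>\<alpha> = 1\<close> and \<open>Re \<beta> > 0\<close>, and a half-plane
  \<open>{w. x0 < Re w}\<close> otherwise; on it the extension of \<open>F\<close> is an automorphism commuting with \<open>T\<close>.
\<close>

lemma half_plane_root_of_affine_is_affine:
  assumes \<alpha>: "1 \<le> \<alpha>" and \<beta>: "0 \<le> Re \<beta>"
    and escape: "\<And>w. w \<in> right_half_plane \<Longrightarrow>
      filterlim (\<lambda>n. (affine_map \<alpha> \<beta> ^^ n) w) at_infinity sequentially"
    and hol: "F holomorphic_on right_half_plane"
    and into: "\<And>w. w \<in> right_half_plane \<Longrightarrow> F w \<in> right_half_plane"
    and n: "1 \<le> n"
    and root: "\<And>w. w \<in> right_half_plane \<Longrightarrow> (F ^^ n) w = affine_map \<alpha> \<beta> w"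
  shows "\<exists>a>0. \<exists>b. \<forall>w\<in>right_half_plane. F w = affine_map a b w"
proof -
  have comm: "F (affine_map \<alpha> \<beta> w) = affine_map \<alpha> \<beta> (F w)" if "w \<in> right_half_plane" for w
    using root[OF that] root[OF into[OF that]] by (metis funpow_swap1)
  interpret commuting_affine "affine_map \<alpha> \<beta>" \<alpha> \<beta> F
    by unfold_locales (use \<alpha> \<beta> hol into comm in auto)
  note bij = extension_bij[OF n root]
  have basin_escape: "filterlim (\<lambda>n. (affine_map \<alpha> \<beta> ^^ n) w) at_infinity sequentially" if w: "w \<in> basin" for w
  proof -
    obtain k where "(affine_map \<alpha> \<beta> ^^ k) w \<in> right_half_plane"
      using w by (rule in_basin_E)
    from escape[OF this] have "filterlim (\<lambda>n. (affine_map \<alpha> \<beta> ^^ (n + k)) w) at_infinity sequentially"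
      by (simp add: funpow_add)
    thus ?thesis
      unfolding filterlim_iff
      using eventually_sequentially_seg[where P = "\<lambda>n. P ((affine_map \<alpha> \<beta> ^^ n) w)" for P] by blast
  qed
  have Re_iter: "Re ((affine_map \<alpha> \<beta> ^^ k) w) = \<alpha> ^ k * (Re w - x0) + x0"
    if "\<alpha> * x0 + Re \<beta> = x0" for x0 w k
  proof (induction k)
    case (Suc k)
    have "Re (affine_map \<alpha> \<beta> v) = \<alpha> * Re v + Re \<beta>" for v
      by (simp add: affine_map_def)
    with Suc have "Re ((affine_map \<alpha> \<beta> ^^ Suc k) w) = \<alpha> * (\<alpha> ^ k * (Re w - x0) + x0) + Re \<beta>"
      by simp
    also have "\<dots> = \<alpha> ^ Suc k * (Re w - x0) + (\<alpha> * x0 + Re \<beta>)"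
      by (simp add: algebra_simps)
    finally show ?case
      using that by simp
  qed simp
  show ?thesis
  proof (cases "\<alpha> = 1 \<and> 0 < Re \<beta>")
    case True
    have "w \<in> basin" for w
    proof -
      obtain k :: nat where "- Re w / Re \<beta> < of_nat k"
        using reals_Archimedean2 by blast
      hence "- Re w < of_nat k * Re \<beta>"
        using True by (simp add: field_simps)
      hence "0 < Re ((affine_map \<alpha> \<beta> ^^ k) w)"
        using True by (simp add: affine_map_funpow mult.commute)
      thus ?thesis
        unfolding basin_def right_half_plane_def by blast
    qed
    hence basin: "basin = UNIV" by blast
    have "extension (w + \<beta>) = extension w + \<beta>" for w
      using extension_T[of w] basin True by (simp add: affine_map_def)
    moreover have "extension w \<in> right_half_plane" if "w \<in> right_half_plane" for w
      using extension_eq_F into that by simp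
    ultimately obtain b where "\<And>w. extension w = w + b"
      using entire_commuting_translation_is_translation[of extension \<beta>] extension_holomorphic basin True by metis
    thus ?thesis
      using extension_eq_F by (intro exI[of _ 1] conjI exI[of _ b]) (auto simp: affine_map_def)
  next
    case False
    \<comment> \<open>The line \<open>Re w = x0\<close> is invariant under the affine map.\<close>
    define x0 where "x0 = (if \<alpha> = 1 then 0 else - Re \<beta> / (\<alpha> - 1))"
    have x0_fixed: "\<alpha> * x0 + Re \<beta> = x0"
      using False assms(2) by (auto simp: x0_def field_simps)
    have x0: "x0 \<le> 0"
      using assms(1,2) by (auto simp: x0_def divide_nonneg_nonneg)
    have basin: "basin = {w. x0 < Re w}"
    proof (intro set_eqI iffI)
      fix w assume "w \<in> basin"
      then obtain k where "0 < \<alpha> ^ k * (Re w - x0) + x0"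
        unfolding basin_def right_half_plane_def Re_iter[OF x0_fixed, symmetric] by blast
      hence "0 < \<alpha> ^ k * (Re w - x0)"
        using x0 by linarith
      thus "w \<in> {w. x0 < Re w}"
        using \<alpha> by (simp add: zero_less_mult_iff)
    next
      fix w assume "w \<in> {w. x0 < Re w}"
      hence w: "0 < Re w - x0" by simp
      have "\<exists>k. - x0 / (Re w - x0) < \<alpha> ^ k"
      proof (cases "\<alpha> = 1")
        case True
        thus ?thesis by (simp add: x0_def)
      next
        case False
        thus ?thesis using assms(1) real_arch_pow by auto
      qed
      then obtain k where "- x0 < \<alpha> ^ k * (Re w - x0)"
        using w by (auto simp: field_simps)
      hence "0 < Re ((affine_map \<alpha> \<beta> ^^ k) w)"
        unfolding Re_iter[OF x0_fixed] by simp
      thus "w \<in> basin"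
        unfolding basin_def right_half_plane_def by blast
    qed
    define c where "c = complex_of_real x0"
    define G where "G u = extension (u + c) - c" for u
    define S where "S u = affine_map \<alpha> \<beta> (u + c) - c" for u
    have plus: "u + c \<in> basin \<longleftrightarrow> u \<in> right_half_plane" for u
      by (auto simp: basin c_def right_half_plane_def)
    have minus: "w - c \<in> right_half_plane \<longleftrightarrow> w \<in> basin" for w
      using plus[of "w - c"] by simp
    have iter: "(S ^^ n) u = (affine_map \<alpha> \<beta> ^^ n) (u + c) - c" for n u
      by (induction n) (simp_all add: S_def)
    have "G holomorphic_on right_half_plane"
    proof -
      have "extension \<circ> (\<lambda>u. u + c) holomorphic_on right_half_plane"
        by (rule holomorphic_on_compose_gen[OF _ extension_holomorphic])
          (auto simp: plus intro!: holomorphic_intros)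
      thus ?thesis
        unfolding G_def by (auto simp: comp_def intro!: holomorphic_intros)
    qed
    moreover have "bij_betw G right_half_plane right_half_plane"
    proof -
      have "bij_betw (\<lambda>u. u + c) right_half_plane basin"
        by (rule bij_betw_byWitness[where f' = "\<lambda>w. w - c"]) (auto simp: plus minus)
      moreover have "bij_betw (\<lambda>w. w - c) basin right_half_plane"
        by (rule bij_betw_byWitness[where f' = "\<lambda>u. u + c"]) (auto simp: plus minus)
      ultimately have "bij_betw ((\<lambda>w. w - c) \<circ> (extension \<circ> (\<lambda>u. u + c))) right_half_plane right_half_plane"
        using bij by (intro bij_betw_trans)
      thus ?thesis
        by (simp add: G_def[abs_def] comp_def)
    qed
    moreover have "S u \<in> right_half_plane" if "u \<in> right_half_plane" for u
      using T_in_basin that by (simp add: S_def plus minus)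
    moreover have "G (S u) = S (G u)" if "u \<in> right_half_plane" for u
      using extension_T[of "u + c"] that by (simp add: G_def S_def plus)
    moreover have "filterlim (\<lambda>n. (S ^^ n) u) at_infinity sequentially" if "u \<in> right_half_plane" for u
      unfolding iter using that
        tendsto_add_filterlim_at_infinity[OF tendsto_const[of "- c"] basin_escape[of "u + c"]]
      by (simp add: plus)
    ultimately have "\<exists>a>0. \<exists>b. \<forall>u\<in>right_half_plane. G u = affine_map a b u"
      by (rule half_plane_automorphism_commuting_is_affine)
    then obtain a b where ab: "0 < a" "\<And>u. u \<in> right_half_plane \<Longrightarrow> G u = affine_map a b u"
      by blast
    show ?thesis
    proof (intro exI[of _ a] exI[of _ "b + c - of_real a * c"] conjI ballI ab(1))
      fix w assume w: "w \<in> right_half_plane"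
      hence "w - c \<in> right_half_plane"
        using x0 by (simp add: right_half_plane_def c_def)
      from ab(2)[OF this] have "extension w = affine_map a (b + c - of_real a * c) w"
        by (simp add: G_def affine_map_def algebra_simps)
      thus "F w = affine_map a (b + c - of_real a * c) w"
        using extension_eq_F[OF w] by simp
    qed
  qed
qed

section \<open>Affine semigroups of the half-plane\<close>

text \<open>
  The integral of \<open>exp (L * u)\<close> over \<open>[0, t]\<close>, the common form of the translation part in the
  parabolic case \<open>L = 0\<close> and the hyperbolic case \<open>L > 0\<close>.
\<close>

definition exp_primitive :: "real \<Rightarrow> real \<Rightarrow> real" where
  "exp_primitive L t = (if L = 0 then t else (exp (L * t) - 1) / L)"

lemma exp_primitive_add:
  "exp_primitive L (s + t) = exp_primitive L s + exp (L * s) * exp_primitive L t"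
  by (simp add: exp_primitive_def exp_add field_simps)

lemma exp_primitive_nonneg: "0 \<le> L \<Longrightarrow> 0 \<le> t \<Longrightarrow> 0 \<le> exp_primitive L t"
  by (simp add: exp_primitive_def)

lemma exp_primitive_pos: "0 \<le> L \<Longrightarrow> 0 < t \<Longrightarrow> 0 < exp_primitive L t"
  by (simp add: exp_primitive_def)

lemma continuous_on_exp_primitive: "continuous_on S (exp_primitive L)"
  unfolding exp_primitive_def[abs_def] by (cases "L = 0") (auto intro!: continuous_intros)

lemma (in disk_chart) affine_semigroup:
  assumes U: "U = right_half_plane" and L: "0 \<le> L" and b: "0 \<le> Re b"
  shows "disk_semigroup (\<lambda>t. k' \<circ> affine_map (exp (L * t)) (b * of_real (exp_primitive L t)) \<circ> k)"
proof (rule disk_semigroup_pull_back)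
  fix t :: real assume t: "0 \<le> t"
  show "affine_map (exp (L * t)) (b * of_real (exp_primitive L t)) holomorphic_on U"
    unfolding affine_map_def[abs_def] by (intro holomorphic_intros)
  fix w assume "w \<in> U"
  thus "affine_map (exp (L * t)) (b * of_real (exp_primitive L t)) w \<in> U"
    unfolding U using b exp_primitive_nonneg[OF L t]
    by (intro affine_map_in_half_plane) auto
next
  fix w show "affine_map (exp (L * 0)) (b * of_real (exp_primitive L 0)) w = w"
    by (simp add: affine_map_def exp_primitive_def)
next
  fix s t :: real and w
  show "affine_map (exp (L * s)) (b * of_real (exp_primitive L s))
          (affine_map (exp (L * t)) (b * of_real (exp_primitive L t)) w)
        = affine_map (exp (L * (s + t))) (b * of_real (exp_primitive L (s + t))) w"
    by (simp add: affine_map_def exp_primitive_add distrib_left exp_add algebra_simps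
        flip: exp_of_real)
next
  have "continuous_on ({0..} \<times> U) (\<lambda>p. exp_primitive L (fst p))"
    by (rule continuous_on_compose2[OF continuous_on_exp_primitive[of UNIV]])
      (auto intro!: continuous_intros)
  thus "continuous_on ({0..} \<times> U)
      (\<lambda>(t, w). affine_map (exp (L * t)) (b * of_real (exp_primitive L t)) w)"
    unfolding affine_map_def case_prod_unfold by (intro continuous_intros)
qed

section \<open>Non-elliptic fractional linear maps in the half-plane model\<close>

lemma tendsto_cayley_at_infinity:
  assumes p: "norm p = 1" and lim: "(\<lambda>n. x n) \<longlonglongrightarrow> p" and x: "\<And>n::nat. x n \<in> unit_disk"
  shows "filterlim (\<lambda>n. cayley p (x n)) at_infinity sequentially"
proof -
  have "filterlim (\<lambda>z. (p + z) / (p - z)) at_infinity (at p)"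
  proof (rule filterlim_divide_at_infinity)
    show "((\<lambda>z. p + z) \<longlongrightarrow> p + p) (at p)"
      by (intro tendsto_intros)
    have "((\<lambda>z. p - z) \<longlongrightarrow> p - p) (at p)"
      by (intro tendsto_intros)
    thus "filterlim (\<lambda>z. p - z) (at 0) (at p)"
      by (auto simp: filterlim_at eventually_at_filter)
    show "p + p \<noteq> 0"
      using p by auto
  qed
  moreover have "filterlim x (at p) sequentially"
  proof -
    have "x n \<noteq> p" for n
      using x[of n] p by auto
    thus ?thesis
      using lim by (simp add: filterlim_at)
  qed
  ultimately show ?thesis
    unfolding cayley_def by (rule filterlim_compose)
qed

text \<open>
  A non-real \<open>a\<close> would turn vertical lines out of the half-plane, and a negative \<open>a\<close> would reverse it;
  letting \<open>w\<close> tend to \<open>0\<close> bounds \<open>Re b\<close>.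
\<close>

lemma half_plane_affine_self_map:
  assumes nz: "a \<noteq> 0" and pos: "\<And>w. w \<in> right_half_plane \<Longrightarrow> 0 < Re (a * w + b)"
  obtains \<alpha> :: real where "a = of_real \<alpha>" "0 < \<alpha>" "0 \<le> Re b"
proof -
  have gen: "0 < Re a * x - Im a * y + Re b" if "0 < x" for x y
    using pos[of "Complex x y"] that by (simp add: right_half_plane_def)
  have im: "Im a = 0"
  proof (rule ccontr)
    assume "Im a \<noteq> 0"
    thus False
      using gen[of 1 "(Re a + Re b) / Im a"] by simp
  qed
  have b: "0 \<le> Re b"
  proof (rule ccontr)
    assume neg: "\<not> 0 \<le> Re b"
    \<comment> \<open>So small that the linear term is at most half of \<open>\<bar>Re b\<bar>\<close>.\<close>
    define x where "x = - Re b / (2 * (\<bar>Re a\<bar> + 1))"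
    have x: "0 < x"
      using neg by (simp add: x_def divide_neg_pos)
    have "Re a * x \<le> (\<bar>Re a\<bar> + 1) * x"
      using x by (intro mult_right_mono) auto
    also have "\<dots> = - Re b / 2"
      by (simp add: x_def field_simps)
    finally show False
      using gen[OF x, of 0] neg by simp
  qed
  have "0 \<le> Re a"
  proof (rule ccontr)
    assume neg: "\<not> 0 \<le> Re a"
    hence "0 < (Re b + 1) / (- Re a)"
      using b by (intro divide_pos_pos) auto
    from gen[OF this, of 0] show False
      using neg by (simp add: divide_simps)
  qed
  moreover have "Re a \<noteq> 0"
    using nz im by (auto simp: complex_eq_iff)
  ultimately show ?thesis
    using that[of "Re a"] im b by (simp add: complex_eq_iff)
qed

text \<open>
  A contraction pulls every orbit to its fixed point \<open>\<beta> / (1 - \<alpha>)\<close>.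
\<close>

lemma affine_orbit_bounded:
  assumes "0 < \<alpha>" "\<alpha> < 1"
  shows "\<not> filterlim (\<lambda>n. (affine_map \<alpha> \<beta> ^^ n) w) at_infinity sequentially"
proof
  assume lim: "filterlim (\<lambda>n. (affine_map \<alpha> \<beta> ^^ n) w) at_infinity sequentially"
  define w0 where "w0 = \<beta> / (1 - of_real \<alpha>)"
  have "1 - complex_of_real \<alpha> \<noteq> 0"
    using assms of_real_eq_1_iff[of \<alpha>, where 'a = complex] by auto
  hence w0: "of_real \<alpha> * w0 + \<beta> = w0"
    by (simp add: w0_def field_simps)
  have orbit: "(affine_map \<alpha> \<beta> ^^ n) w = of_real (\<alpha> ^ n) * (w - w0) + w0" for n
  proof (induction n)
    case (Suc n)
    have "affine_map \<alpha> \<beta> (of_real (\<alpha> ^ n) * (w - w0) + w0)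
        = of_real (\<alpha> ^ Suc n) * (w - w0) + (of_real \<alpha> * w0 + \<beta>)"
      by (simp add: affine_map_def algebra_simps)
    thus ?case
      using Suc w0 by simp
  qed simp
  have "(\<lambda>n. of_real (\<alpha> ^ n) * (w - w0) + w0) \<longlonglongrightarrow> of_real 0 * (w - w0) + w0"
    using assms by (intro tendsto_add tendsto_mult tendsto_of_real LIMSEQ_realpow_zero tendsto_const) auto
  hence "(\<lambda>n. (affine_map \<alpha> \<beta> ^^ n) w) \<longlonglongrightarrow> of_real 0 * (w - w0) + w0"
    unfolding orbit .
  from not_tendsto_and_filterlim_at_infinity[OF sequentially_bot this lim] show False .
qed

text \<open>
  In the half-plane the Denjoy--Wolff point is infinity and all orbits escape to it. If the map had a
  finite limit \<open>a / c\<close> at infinity, an escaping orbit would at the same time converge to that limit;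
  so \<open>c = 0\<close>. The angular derivative at \<open>p\<close> corresponds to \<open>1 / \<alpha>\<close>, and \<open>\<alpha> \<ge> 1\<close> comes from escape.
\<close>

lemma non_elliptic_fractional_linear_is_affine:
  assumes lf: "linear_fractional_self_map \<phi>" and ne: "\<not> elliptic \<phi>"
    and dw: "denjoy_wolff_point \<phi> p"
  obtains \<alpha> \<beta> where "norm p = 1" "1 \<le> \<alpha>" "0 \<le> Re \<beta>"
    "\<And>w. w \<in> right_half_plane \<Longrightarrow> (cayley p \<circ> \<phi> \<circ> cayley_inv p) w = affine_map \<alpha> \<beta> w"
    "\<And>w. w \<in> right_half_plane \<Longrightarrow>
      filterlim (\<lambda>n. (affine_map \<alpha> \<beta> ^^ n) w) at_infinity sequentially"
proof -
  have sm: "self_map \<phi>"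
    using lf by (simp add: linear_fractional_self_map_def)
  have p: "norm p = 1"
    and dwlim: "\<forall>K. compact K \<and> K \<subseteq> unit_disk \<longrightarrow>
        uniform_limit K (\<lambda>n. \<phi> ^^ n) (\<lambda>_. p) sequentially"
    using dw ne by (auto simp: denjoy_wolff_point_def)
  interpret disk_chart right_half_plane "cayley p" "cayley_inv p"
    by (rule disk_chart_cayley[OF p])
  define T where "T = cayley p \<circ> \<phi> \<circ> cayley_inv p"
  have T_into: "T w \<in> right_half_plane" if "w \<in> right_half_plane" for w
    unfolding T_def using push_forward_maps_to[OF sm that] .
  have escape: "filterlim (\<lambda>n. (T ^^ n) w) at_infinity sequentially" if w: "w \<in> right_half_plane" for w
  proof -
    define z where "z = cayley_inv p w"
    have z: "z \<in> unit_disk"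
      using inv_maps_to w by (simp add: z_def)
    have in_disk: "(\<phi> ^^ n) z \<in> unit_disk" for n
      using funpow_maps_to[OF self_map_in_disk[OF sm] z] .
    have "(T ^^ n) w = cayley p ((\<phi> ^^ n) z)" for n
    proof (induction n)
      case 0
      show ?case using right_inv w by (simp add: z_def)
    next
      case (Suc n)
      thus ?case using left_inv[OF in_disk[of n]] by (simp add: T_def)
    qed
    moreover from dwlim[rule_format, of "{z}"] z have "(\<lambda>n. (\<phi> ^^ n) z) \<longlonglongrightarrow> p"
      by simp
    ultimately show ?thesis
      using tendsto_cayley_at_infinity[OF p _ in_disk] by simp
  qed
  have "fractional_linear_on unit_disk \<phi>"
    using lf by (simp add: linear_fractional_self_map_def fractional_linear_on_def)
  hence "fractional_linear_on unit_disk (cayley p \<circ> \<phi>)"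
    using fractional_linear_on_compose[OF _ fractional_linear_cayley[OF p]] self_map_in_disk[OF sm]
    by blast
  hence "fractional_linear_on right_half_plane T"
    unfolding T_def using fractional_linear_on_compose[OF fractional_linear_cayley_inv[OF p]] inv_maps_to
    by blast
  then obtain a b c d where det: "a * d - b * c \<noteq> 0"
    and form: "\<And>w. w \<in> right_half_plane \<Longrightarrow> c * w + d \<noteq> 0 \<and> T w = (a * w + b) / (c * w + d)"
    unfolding fractional_linear_on_def by metis
  have one: "1 \<in> right_half_plane"
    by (simp add: right_half_plane_def)
  have "c = 0"
  proof (rule ccontr)
    assume "c \<noteq> 0"
    have "(\<lambda>n. (a * (T ^^ n) 1 + b) / (c * (T ^^ n) 1 + d)) \<longlonglongrightarrow> a / c"
      by (rule filterlim_compose[OF fractional_linear_at_infinity[OF \<open>c \<noteq> 0\<close>] escape[OF one]])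
    moreover have "(a * (T ^^ n) 1 + b) / (c * (T ^^ n) 1 + d) = (T ^^ n) (T 1)" for n
      using form[of "(T ^^ n) 1"] funpow_maps_to[where f = T and n = n, OF T_into one] funpow_swap1[where f = T and n = n and x = 1] by simp
    ultimately show False
      using escape[OF T_into[OF one]] not_tendsto_and_filterlim_at_infinity[OF sequentially_bot]
      by force
  qed
  hence ad: "a \<noteq> 0" "d \<noteq> 0"
    using det by auto
  have T_eq: "T w = (a / d) * w + b / d" if "w \<in> right_half_plane" for w
    using form[OF that] \<open>c = 0\<close> by (simp add: add_divide_distrib)
  obtain \<alpha> :: real where \<alpha>: "a / d = of_real \<alpha>" "0 < \<alpha>" "0 \<le> Re (b / d)"
  proof (rule half_plane_affine_self_map[of "a / d" "b / d"])
    show "0 < Re (a / d * w + b / d)" if "w \<in> right_half_plane" for w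
      using T_into[OF that] T_eq[OF that] by (simp add: right_half_plane_def)
  qed (use ad in auto)
  define \<beta> where beta_def: "\<beta> = b / d"
  have T_aff: "T w = affine_map \<alpha> \<beta> w" if "w \<in> right_half_plane" for w
    using T_eq[OF that] \<alpha>(1) by (simp add: affine_map_def beta_def)
  have iter: "(T ^^ n) w = (affine_map \<alpha> \<beta> ^^ n) w" if "w \<in> right_half_plane" for w n
  proof (induction n)
    case (Suc n)
    thus ?case
      using T_aff[OF funpow_maps_to[where f = T and n = n, OF T_into that]] by simp
  qed simp
  have esc: "filterlim (\<lambda>n. (affine_map \<alpha> \<beta> ^^ n) w) at_infinity sequentially"
    if "w \<in> right_half_plane" for w
    using escape[OF that] iter[OF that] by simp
  have "1 \<le> \<alpha>"
    using affine_orbit_bounded[OF \<alpha>(2)] esc[OF one] by force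
  thus ?thesis
    using that[of \<alpha> \<beta>] p \<alpha>(3) T_aff esc by (simp add: T_def beta_def)
qed

text \<open>
  The maps \<open>g (s / n)\<close> and \<open>h (s / n)\<close> are \<open>n\<close>-th iterative roots of the same affine map.
\<close>

lemma non_elliptic_semigroup_unique:
  assumes lf: "linear_fractional_self_map \<phi>" and ne: "\<not> elliptic \<phi>"
    and dw: "denjoy_wolff_point \<phi> p" and s: "0 < s"
    and g: "disk_semigroup g" "eq_on_disk (g s) \<phi>"
    and h: "disk_semigroup h" "eq_on_disk (h s) \<phi>"
  shows "eq_semigroup h g"
proof (rule eq_semigroup_if_roots_eq[OF h(1) g(1) s])
  obtain \<alpha> \<beta> where p: "norm p = 1" and \<alpha>: "1 \<le> \<alpha>" and \<beta>: "0 \<le> Re \<beta>"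
    and form: "\<And>w. w \<in> right_half_plane \<Longrightarrow> (cayley p \<circ> \<phi> \<circ> cayley_inv p) w = affine_map \<alpha> \<beta> w"
    and escape: "\<And>w. w \<in> right_half_plane \<Longrightarrow>
      filterlim (\<lambda>n. (affine_map \<alpha> \<beta> ^^ n) w) at_infinity sequentially"
    using non_elliptic_fractional_linear_is_affine[OF lf ne dw] by metis
  interpret disk_chart right_half_plane "cayley p" "cayley_inv p"
    by (rule disk_chart_cayley[OF p])
  fix n :: nat assume n: "1 \<le> n"
  define r where "r = s / of_nat n"
  have r: "0 \<le> r" "of_nat n * r = s"
    using s n by (auto simp: r_def)
  have root: "((cayley p \<circ> f r \<circ> cayley_inv p) ^^ n) w = affine_map \<alpha> \<beta> w"
    if "disk_semigroup f" "eq_on_disk (f s) \<phi>" "w \<in> right_half_plane" for f w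
    using push_forward_funpow[OF disk_semigroup_self_map[OF that(1) r(1)] that(3)]
      disk_semigroup_funpow[OF that(1) r(1) inv_maps_to[OF that(3)]] that(2) inv_maps_to[OF that(3)]
      form[OF that(3)] r(2)
    by (simp add: eq_on_disk_def)
  have affine: "\<exists>a>0. \<exists>b. \<forall>w\<in>right_half_plane.
      (cayley p \<circ> f r \<circ> cayley_inv p) w = affine_map a b w"
    if "disk_semigroup f" "eq_on_disk (f s) \<phi>" for f
    using half_plane_root_of_affine_is_affine[OF \<alpha> \<beta> escape _ _ n root[OF that]]
      push_forward_holomorphic[OF disk_semigroup_self_map[OF that(1) r(1)]]
      push_forward_maps_to[OF disk_semigroup_self_map[OF that(1) r(1)]] by blast
  obtain a b where ab: "0 < a" "\<forall>w\<in>right_half_plane.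
      (cayley p \<circ> h r \<circ> cayley_inv p) w = affine_map a b w"
    using affine[OF h] by blast
  obtain a' b' where ab': "0 < a'" "\<forall>w\<in>right_half_plane.
      (cayley p \<circ> g r \<circ> cayley_inv p) w = affine_map a' b' w"
    using affine[OF g] by blast
  have iterate: "(F ^^ m) w = (affine_map c d ^^ m) w"
    if eq: "\<forall>w\<in>right_half_plane. F w = affine_map c d w" and F: "\<And>w. w \<in> right_half_plane \<Longrightarrow> F w \<in> right_half_plane"
      and w: "w \<in> right_half_plane" for F c d m w
  proof (induction m)
    case (Suc m)
    thus ?case
      using eq funpow_maps_to[where f = F and n = m, OF F w] by simp
  qed simp
  have "a = a' \<and> b = b'"
  proof (rule affine_map_funpow_root_unique[OF ab(1) ab'(1) n])
    fix w assume w: "w \<in> right_half_plane"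
    show "(affine_map a b ^^ n) w = (affine_map a' b' ^^ n) w"
      using iterate[OF ab(2) push_forward_maps_to[OF disk_semigroup_self_map[OF h(1) r(1)]] w]
        iterate[OF ab'(2) push_forward_maps_to[OF disk_semigroup_self_map[OF g(1) r(1)]] w]
        root[OF h w] root[OF g w] by metis
  qed
  hence "eq_on_disk (h r) (g r)"
    using ab(2) ab'(2) disk_semigroup_self_map[OF h(1) r(1)] disk_semigroup_self_map[OF g(1) r(1)]
    by (intro eq_on_disk_if_push_forward_eq) auto
  thus "eq_on_disk (h (s / of_nat n)) (g (s / of_nat n))"
    by (simp add: r_def)
qed

text \<open>
  The flow \<open>w \<mapsto> e\<^sup>L\<^sup>t w + b \<integral> e\<^sup>L\<^sup>u du\<close>, the integral being over \<open>[0, t]\<close>, with \<open>L\<close> and \<open>b\<close> adjusted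
  to give \<open>\<alpha> w + \<beta>\<close> at time \<open>s\<close>.
\<close>

lemma non_elliptic_semigroup_exists:
  assumes lf: "linear_fractional_self_map \<phi>" and ne: "\<not> elliptic \<phi>"
    and dw: "denjoy_wolff_point \<phi> p" and s: "0 < s"
  shows "\<exists>g. disk_semigroup g \<and> eq_on_disk (g s) \<phi>"
proof -
  obtain \<alpha> \<beta> where p: "norm p = 1" and \<alpha>: "1 \<le> \<alpha>" and \<beta>: "0 \<le> Re \<beta>"
    and form: "\<And>w. w \<in> right_half_plane \<Longrightarrow> (cayley p \<circ> \<phi> \<circ> cayley_inv p) w = affine_map \<alpha> \<beta> w"
    using non_elliptic_fractional_linear_is_affine[OF lf ne dw] by metis
  interpret disk_chart right_half_plane "cayley p" "cayley_inv p"
    by (rule disk_chart_cayley[OF p])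
  define L where "L = ln \<alpha> / s"
  define b where "b = \<beta> / of_real (exp_primitive L s)"
  have L: "0 \<le> L" "exp (L * s) = \<alpha>"
    using \<alpha> s by (auto simp: L_def)
  note E = exp_primitive_pos[OF L(1) s]
  have b: "0 \<le> Re b" "b * of_real (exp_primitive L s) = \<beta>"
    using E \<beta> by (auto simp: b_def Re_divide_of_real)
  let ?g = "\<lambda>t. cayley_inv p \<circ> affine_map (exp (L * t)) (b * of_real (exp_primitive L t)) \<circ> cayley p"
  have g: "disk_semigroup ?g"
    by (rule affine_semigroup[OF refl L(1) b(1)])
  moreover have "eq_on_disk (?g s) \<phi>"
  proof (rule eq_on_disk_if_push_forward_eq)
    show "self_map (?g s)"
      using disk_semigroup_self_map[OF g less_imp_le[OF s]] .
    show "self_map \<phi>"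
      using lf by (simp add: linear_fractional_self_map_def)
    fix w assume w: "w \<in> right_half_plane"
    have "affine_map \<alpha> \<beta> w \<in> right_half_plane"
      using affine_map_in_half_plane[OF _ \<beta> w, of \<alpha>] \<alpha> by simp
    thus "(cayley p \<circ> ?g s \<circ> cayley_inv p) w = (cayley p \<circ> \<phi> \<circ> cayley_inv p) w"
      using form[OF w] right_inv w by (simp add: L(2) b(2))
  qed
  ultimately show ?thesis
    by blast
qed

section \<open>Fractional linear self-maps fixing the origin\<close>

text \<open>
  Approaching the boundary in the direction in which \<open>C z\<close> is negative real, the modulus of the
  denominator tends to \<open>1 - \<bar>C\<bar>\<close> and that of the numerator to \<open>\<bar>A\<bar>\<close>.
\<close>

lemma norm_bound_of_self_map_fixing_zero:
  assumes nz: "\<And>z. z \<in> unit_disk \<Longrightarrow> C * z + 1 \<noteq> 0"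
    and into: "\<And>z. z \<in> unit_disk \<Longrightarrow> A * z / (C * z + 1) \<in> unit_disk"
  shows "norm A + norm C \<le> 1"
proof (rule field_le_mult_one_interval)
  have C1: "norm C \<le> 1"
  proof (rule ccontr)
    assume "\<not> norm C \<le> 1"
    hence C: "1 < norm C" "C \<noteq> 0"
      by auto
    hence "- 1 / C \<in> unit_disk"
      by (simp add: norm_divide)
    thus False
      using nz[of "- 1 / C"] C(2) by simp
  qed
  fix r :: real assume r: "0 < r" "r < 1"
  define u where "u = (if C = 0 then 1 else cnj (sgn C))"
  have u: "norm u = 1" "C * u = of_real (norm C)"
  proof -
    show "norm u = 1"
      by (simp add: u_def norm_sgn)
    have "C * cnj (sgn C) = C * cnj C / of_real (norm C)"
      by (simp add: sgn_eq)
    also have "\<dots> = of_real (norm C)"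
      by (simp add: complex_norm_square[symmetric] power2_eq_square)
    finally show "C * u = of_real (norm C)"
      by (simp add: u_def)
  qed
  define z where "z = - (of_real r * u)"
  have z: "z \<in> unit_disk" "norm z = r"
    using r u by (auto simp: z_def norm_mult)
  have "C * z + 1 = of_real (1 - r * norm C)"
    unfolding z_def using u(2) by (simp add: mult.left_commute)
  moreover have rC: "0 < 1 - r * norm C"
  proof -
    have "r * norm C \<le> r"
      using C1 r by (simp add: mult_left_le)
    thus ?thesis using r by linarith
  qed
  ultimately have "norm (C * z + 1) = 1 - r * norm C"
    by (metis abs_of_pos norm_of_real)
  hence "norm A * r / (1 - r * norm C) < 1"
    using into[OF z(1)] z(2) by (simp add: norm_divide norm_mult)
  hence "norm A * r < 1 - r * norm C"
    using rC by simp
  thus "r * (norm A + norm C) \<le> 1"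
    by (simp add: algebra_simps)
qed

lemma self_map_fixing_zero_of_norm_bound:
  assumes bound: "norm A + norm C \<le> 1" and z: "z \<in> unit_disk"
  shows "C * z + 1 \<noteq> 0" "A * z / (C * z + 1) \<in> unit_disk"
proof -
  have z1: "norm z < 1" using z by simp
  have "norm A * norm z \<le> (1 - norm C) * norm z"
    using bound by (intro mult_right_mono) auto
  also have "\<dots> < 1 - norm C * norm z"
    using z1 by (simp add: algebra_simps)
  also have "\<dots> \<le> norm (C * z + 1)"
    using norm_triangle_ineq4[of "C * z + 1" "C * z"] by (simp add: norm_mult)
  finally have lt: "norm (A * z) < norm (C * z + 1)"
    by (simp add: norm_mult)
  hence pos: "0 < norm (C * z + 1)"
    using norm_ge_zero order_le_less_trans by blast
  thus "C * z + 1 \<noteq> 0"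
    by simp
  show "A * z / (C * z + 1) \<in> unit_disk"
    using lt pos by (simp add: norm_divide)
qed

text \<open>
  The map that \<open>z / (1 + k z)\<close> conjugates to multiplication by \<open>a\<close>. For fixed \<open>k\<close>
  composing two such maps multiplies their parameters \<open>a\<close>.
\<close>

definition linear_model :: "complex \<Rightarrow> complex \<Rightarrow> complex \<Rightarrow> complex" where
  "linear_model k a z = a * z / ((1 - a) * k * z + 1)"

lemma linear_model_semigroup:
  assumes p: "norm p < 1"
    and bound: "\<And>t. 0 \<le> t \<Longrightarrow> norm (exp (of_real t * c)) + norm ((1 - exp (of_real t * c)) * k) \<le> 1"
  shows "disk_semigroup (\<lambda>t. disk_involution p \<circ> linear_model k (exp (of_real t * c)) \<circ> disk_involution p)"
proof -
  interpret disk_chart unit_disk "disk_involution p" "disk_involution p"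
    by (rule disk_chart_involution[OF p])
  have nz: "(1 - exp (of_real t * c)) * k * z + 1 \<noteq> 0" if "0 \<le> t" "z \<in> unit_disk" for t z
    using self_map_fixing_zero_of_norm_bound(1)[OF bound that(2)] that(1) by blast
  show ?thesis
  proof (rule disk_semigroup_pull_back)
    fix t :: real assume t: "0 \<le> t"
    show "linear_model k (exp (of_real t * c)) holomorphic_on unit_disk"
      unfolding linear_model_def[abs_def] using nz[OF t] by (intro holomorphic_intros) auto
    fix z assume z: "z \<in> unit_disk"
    show "linear_model k (exp (of_real t * c)) z \<in> unit_disk"
      unfolding linear_model_def using self_map_fixing_zero_of_norm_bound(2)[OF bound[OF t] z] .
  next
    fix z show "linear_model k (exp (of_real 0 * c)) z = z"
      by (simp add: linear_model_def)
  next
    fix s t :: real and z assume st: "0 \<le> s" "0 \<le> t" and z: "z \<in> unit_disk"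
    define a b where "a = exp (of_real s * c)" and "b = exp (of_real t * c)"
    have ab: "exp (of_real (s + t) * c) = a * b"
      by (simp add: a_def b_def exp_add distrib_right)
    define q where "q = (1 - b) * k * z + 1"
    define r where "r = (1 - a * b) * k * z + 1"
    have q: "q \<noteq> 0"
      using nz[OF st(2) z] by (simp add: q_def b_def)
    have "(1 - a) * k * (b * z / q) + 1 = r / q"
      using q by (simp add: q_def r_def field_simps)
    thus "linear_model k (exp (of_real s * c)) (linear_model k (exp (of_real t * c)) z)
        = linear_model k (exp (of_real (s + t) * c)) z"
      unfolding ab unfolding a_def[symmetric] b_def[symmetric]
      unfolding linear_model_def q_def[symmetric] r_def[symmetric]
      using q by simp
  next
    show "continuous_on ({0..} \<times> unit_disk) (\<lambda>(t, z). linear_model k (exp (of_real t * c)) z)"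
      unfolding linear_model_def case_prod_unfold using nz
      by (intro continuous_intros) auto
  qed
qed

text \<open>
  The Koenigs function of \<open>linear_model k a\<close> for \<open>0 < \<bar>a\<bar> < 1\<close>; it is the same for all such \<open>a\<close>.
\<close>

definition linearizer :: "complex \<Rightarrow> complex \<Rightarrow> complex" where
  "linearizer k z = z / (1 + k * z)"

lemma linearizer_denominator_nonzero:
  assumes "norm k \<le> 1" "z \<in> unit_disk"
  shows "1 + k * z \<noteq> 0"
proof
  assume "1 + k * z = 0"
  hence "norm k * norm z = 1"
    by (metis add_eq_0_iff norm_minus_cancel norm_mult norm_one)
  moreover have "norm k * norm z \<le> 1 * norm z"
    using assms by (intro mult_right_mono) auto
  ultimately show False
    using assms by simp
qed

lemma linearizer_linear_model:
  assumes k: "norm k \<le> 1" and z: "z \<in> unit_disk" and nz: "(1 - a) * k * z + 1 \<noteq> 0"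
  shows "linearizer k (linear_model k a z) = a * linearizer k z"
proof -
  have "1 + k * (a * z / ((1 - a) * k * z + 1)) = (1 + k * z) / ((1 - a) * k * z + 1)"
    using nz by (simp add: field_simps)
  thus ?thesis
    using nz linearizer_denominator_nonzero[OF k z] by (simp add: linearizer_def linear_model_def)
qed

lemma linearizer_eqD:
  assumes k: "norm k \<le> 1" and z: "z \<in> unit_disk" and w: "w \<in> unit_disk"
    and eq: "linearizer k w = a * linearizer k z" and a: "a \<noteq> 0"
  shows "(1 - a) * k * z + 1 \<noteq> 0" "w = linear_model k a z"
proof -
  have "w * (1 + k * z) = a * z * (1 + k * w)"
    using eq linearizer_denominator_nonzero[OF k z] linearizer_denominator_nonzero[OF k w]
    by (simp add: linearizer_def frac_eq_eq mult.commute)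
  hence e: "w * ((1 - a) * k * z + 1) = a * z"
    by (simp add: algebra_simps)
  show nz: "(1 - a) * k * z + 1 \<noteq> 0"
  proof
    assume 0: "(1 - a) * k * z + 1 = 0"
    hence "z = 0"
      using e a by simp
    thus False
      using 0 by simp
  qed
  show "w = linear_model k a z"
    using e nz by (simp add: linear_model_def field_simps)
qed

lemma linearizer_tendsto_zeroD:
  assumes k: "norm k \<le> 1" and x: "\<And>n::nat. x n \<in> unit_disk"
    and lim: "(\<lambda>n. linearizer k (x n)) \<longlonglongrightarrow> 0"
  shows "x \<longlonglongrightarrow> 0"
proof -
  have "x n = linearizer k (x n) / (1 - k * linearizer k (x n))" for n
    using linearizer_denominator_nonzero[OF k x[of n]] by (simp add: linearizer_def field_simps)
  moreover have "(\<lambda>n. linearizer k (x n) / (1 - k * linearizer k (x n))) \<longlonglongrightarrow> 0 / (1 - k * 0)"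
    by (intro tendsto_intros lim) auto
  ultimately show ?thesis
    by simp
qed

text \<open>
  With \<open>\<sigma> = linearizer k\<close>, the quotient \<open>\<sigma> (G z) / \<sigma> z\<close> does not change when \<open>z\<close> is replaced by \<open>f z\<close>.
  Orbits of \<open>f\<close> tend to \<open>0\<close>, where the quotient has the limit \<open>G' 0\<close>, so it equals that limit
  throughout.
\<close>

lemma commuting_with_linear_model:
  assumes k: "norm k \<le> 1" and A: "A \<noteq> 0" "norm A < 1"
    and f: "\<And>z. z \<in> unit_disk \<Longrightarrow> f z \<in> unit_disk"
    and sf: "\<And>z. z \<in> unit_disk \<Longrightarrow> linearizer k (f z) = A * linearizer k z"
    and G: "self_map G" "G 0 = 0"
    and comm: "\<And>z. z \<in> unit_disk \<Longrightarrow> G (f z) = f (G z)"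
  shows "\<exists>a. \<forall>z\<in>unit_disk. linearizer k (G z) = a * linearizer k z"
proof -
  define h where "h z = linearizer k (G z)" for z
  have G_into: "G z \<in> unit_disk" if "z \<in> unit_disk" for z
    using self_map_in_disk[OF G(1) that] .
  have "h holomorphic_on unit_disk"
    unfolding h_def linearizer_def using G(1) linearizer_denominator_nonzero[OF k G_into]
    by (intro holomorphic_intros) (auto simp: self_map_def)
  hence "h field_differentiable (at 0)"
    by (rule holomorphic_on_imp_differentiable_at) auto
  then obtain a where "(h has_field_derivative a) (at 0)"
    by (auto simp: field_differentiable_def)
  hence h': "((\<lambda>z. h z / z) \<longlongrightarrow> a) (at 0)"
    using G(2) by (simp add: DERIV_def h_def linearizer_def)
  have "h z = a * linearizer k z" if z: "z \<in> unit_disk" for z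
  proof (cases "z = 0")
    case True
    thus ?thesis using G(2) by (simp add: h_def linearizer_def)
  next
    case False
    define x where "x n = (f ^^ n) z" for n
    have x: "x n \<in> unit_disk" for n
      unfolding x_def using funpow_maps_to[where f = f and n = n, OF f z] .
    have sx: "linearizer k (x n) = A ^ n * linearizer k z" for n
      by (induction n) (use sf[OF x] in \<open>simp_all add: x_def\<close>)
    have hx: "h (x n) = A ^ n * h z" for n
    proof (induction n)
      case (Suc n)
      have "h (x (Suc n)) = linearizer k (f (G (x n)))"
        using comm[OF x[of n]] by (simp add: h_def x_def)
      also have "\<dots> = A * h (x n)"
        using sf[OF G_into[OF x[of n]]] by (simp add: h_def)
      finally show ?case
        using Suc by simp
    qed (simp add: x_def)
    have sz: "linearizer k z \<noteq> 0"
      using False linearizer_denominator_nonzero[OF k z] by (simp add: linearizer_def)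
    have x0: "x n \<noteq> 0" for n
    proof
      assume "x n = 0"
      hence "A ^ n * linearizer k z = 0"
        using sx[of n] by (simp add: linearizer_def)
      thus False using A sz by simp
    qed
    have "(\<lambda>n. A ^ n * linearizer k z) \<longlonglongrightarrow> 0"
      using tendsto_mult_left_zero[OF LIMSEQ_power_zero[OF A(2)]] .
    hence lim: "x \<longlonglongrightarrow> 0"
      using linearizer_tendsto_zeroD[OF k x] by (simp add: sx)
    hence "filterlim x (at 0) sequentially"
      using x0 by (simp add: filterlim_at)
    hence "(\<lambda>n. h (x n) / x n) \<longlonglongrightarrow> a"
      by (rule filterlim_compose[OF h'])
    moreover have "(\<lambda>n. 1 + k * x n) \<longlonglongrightarrow> 1 + k * 0"
      by (intro tendsto_intros lim)
    ultimately have "(\<lambda>n. h (x n) / x n * (1 + k * x n)) \<longlonglongrightarrow> a * (1 + k * 0)"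
      by (rule tendsto_mult)
    moreover have "h (x n) / x n * (1 + k * x n) = h z / linearizer k z" for n
    proof -
      have "h (x n) / x n * (1 + k * x n) = h (x n) / linearizer k (x n)"
        by (simp add: linearizer_def)
      thus ?thesis
        using hx[of n] sx[of n] A(1) by simp
    qed
    ultimately have "h z / linearizer k z = a"
      using LIMSEQ_const_iff by force
    thus ?thesis
      using sz by (simp add: field_simps)
  qed
  thus ?thesis
    unfolding h_def by blast
qed

section \<open>Sequences of iterated square roots\<close>

lemma iterated_square_roots_power:
  fixes a :: "nat \<Rightarrow> 'a::comm_monoid_mult"
  assumes "\<And>n. (a (Suc n))\<^sup>2 = a n"
  shows "a (m + n) ^ (2 ^ n) = a m"
proof (induction n)
  case (Suc n)
  have "a (m + Suc n) ^ (2 ^ Suc n) = ((a (Suc (m + n)))\<^sup>2) ^ (2 ^ n)"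
    by (simp add: power_mult)
  also have "\<dots> = a m"
    unfolding assms using Suc .
  finally show ?case .
qed simp

text \<open>
  The modulus of \<open>a n\<close> is the positive root of \<open>\<bar>a 0\<bar>\<close> of order \<open>2 ^ n\<close>.
\<close>

lemma iterated_square_roots_norm_tendsto_1:
  fixes a :: "nat \<Rightarrow> complex"
  assumes sq: "\<And>n. (a (Suc n))\<^sup>2 = a n" and nz: "a 0 \<noteq> 0"
  shows "(\<lambda>n. norm (a n)) \<longlonglongrightarrow> 1"
proof -
  define c where "c = norm (a 0)"
  have "norm (a n) = root (2 ^ n) c" for n
  proof -
    have "norm (a n) ^ (2 ^ n) = c"
      using iterated_square_roots_power[where a = a and m = 0 and n = n, OF sq]
      by (simp add: c_def flip: norm_power)
    thus ?thesis
      using real_root_power_cancel[of "2 ^ n" "norm (a n)"] by simp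
  qed
  moreover have "(\<lambda>n. root (2 ^ n) c) \<longlonglongrightarrow> 1"
  proof -
    have "strict_mono (\<lambda>n. 2 ^ n :: nat)"
      by (rule strict_monoI) simp
    from LIMSEQ_subseq_LIMSEQ[OF LIMSEQ_root_const[of c] this] nz show ?thesis
      by (simp add: comp_def c_def)
  qed
  ultimately show ?thesis
    by simp
qed

text \<open>
  The closure of the root region under multiplication, from
  \<open>1 - z w = (1 - z) + z (1 - w)\<close>. It reflects that the self-maps \<open>linear_model k a\<close> compose.
\<close>

lemma stolz_condition_mult:
  fixes z w :: complex
  assumes "M * norm (1 - z) \<le> 1 - norm z" "M * norm (1 - w) \<le> 1 - norm w" "0 \<le> M"
  shows "M * norm (1 - z * w) \<le> 1 - norm (z * w)"
proof -
  have "norm (1 - z * w) \<le> norm (1 - z) + norm z * norm (1 - w)"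
  proof -
    have "1 - z * w = (1 - z) + z * (1 - w)"
      by (simp add: algebra_simps)
    thus ?thesis
      using norm_triangle_ineq[of "1 - z" "z * (1 - w)"] by (simp only: norm_mult)
  qed
  from mult_left_mono[OF this assms(3)]
  have "M * norm (1 - z * w) \<le> M * norm (1 - z) + norm z * (M * norm (1 - w))"
    by (simp add: algebra_simps)
  also have "\<dots> \<le> (1 - norm z) + norm z * (1 - norm w)"
    using assms by (intro add_mono mult_left_mono) auto
  also have "\<dots> = 1 - norm (z * w)"
    by (simp add: norm_mult algebra_simps)
  finally show ?thesis .
qed

lemma stolz_condition_power:
  fixes z :: complex
  assumes "M * norm (1 - z) \<le> 1 - norm z" "0 \<le> M"
  shows "M * norm (1 - z ^ n) \<le> 1 - norm (z ^ n)"
proof (induction n)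
  case (Suc n)
  show ?case
    using stolz_condition_mult[OF assms(1) Suc assms(2)] by simp
qed simp

text \<open>
  A square root with positive real part is the principal one, and \<open>exp (L / 2 ^ n)\<close> has positive real
  part for every \<open>n\<close> because \<open>Im L\<close> is less than \<open>\<pi> / 2\<close> in modulus.
\<close>

lemma square_roots_eventually_principal:
  fixes a :: "nat \<Rightarrow> complex"
  assumes sq: "\<And>n. (a (Suc n))\<^sup>2 = a n" and re: "\<And>n. 0 < Re (a n)"
  shows "a n = exp (Ln (a 0) / 2 ^ n)"
proof (induction n)
  case 0
  have "a 0 \<noteq> 0"
    using re[of 0] by auto
  thus ?case by simp
next
  case (Suc n)
  define b where "b = exp (Ln (a 0) / 2 ^ Suc n)"
  have "a 0 \<noteq> 0"
    using re[of 0] by auto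
  hence im: "\<bar>Im (Ln (a 0))\<bar> < pi / 2"
    using Re_Ln_pos_lt re by blast
  have "\<bar>Im (Ln (a 0) / 2 ^ Suc n)\<bar> = \<bar>Im (Ln (a 0))\<bar> / 2 ^ Suc n"
    using Im_divide_of_real[of "Ln (a 0)" "2 ^ Suc n"] by simp
  also have "\<dots> \<le> \<bar>Im (Ln (a 0))\<bar> / 1"
    by (intro divide_left_mono) (auto intro: one_le_power simp del: power_Suc)
  finally have "- (pi / 2) < Im (Ln (a 0) / 2 ^ Suc n)" "Im (Ln (a 0) / 2 ^ Suc n) < pi / 2"
    using im by linarith+
  hence b_re: "0 < Re b"
    unfolding b_def Re_exp by (intro mult_pos_pos cos_gt_zero_pi exp_gt_zero)
  have "b\<^sup>2 = exp (Ln (a 0) / 2 ^ n)"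
    unfolding b_def by (simp flip: exp_double)
  hence "(a (Suc n))\<^sup>2 = b\<^sup>2"
    using sq[of n] Suc by simp
  hence "a (Suc n) = b \<or> a (Suc n) = - b"
    by (simp add: power2_eq_iff)
  moreover have "a (Suc n) \<noteq> - b"
    using re[of "Suc n"] b_re by auto
  ultimately show ?case
    by (simp add: b_def)
qed

text \<open>
  For \<open>M > 0\<close> the Stolz condition forces \<open>a n\<close> to tend to \<open>1\<close> along with its modulus, so all roots past
  some index \<open>N\<close> are principal and \<open>2 ^ N Ln (a N)\<close> is a consistent logarithm of the whole sequence.
  Closure under powers then gives the condition at all dyadic exponents of level at least \<open>N\<close>.
  For \<open>M = 0\<close> nothing controls the arguments of the roots, but any logarithm of \<open>a 0\<close> will do.
\<close>

lemma square_roots_give_exponent: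
  fixes a :: "nat \<Rightarrow> complex"
  assumes sq: "\<And>n. (a (Suc n))\<^sup>2 = a n" and a0: "a 0 \<noteq> 0" "norm (a 0) < 1"
    and M: "0 \<le> M" and stolz: "\<And>n. M * norm (1 - a n) \<le> 1 - norm (a n)"
  shows "\<exists>c. exp c = a 0 \<and>
    (\<forall>t\<ge>0. M * norm (1 - exp (of_real t * c)) \<le> 1 - norm (exp (of_real t * c)))"
proof (cases "M = 0")
  case True
  have "norm (exp (of_real t * Ln (a 0))) \<le> 1" if "0 \<le> t" for t
    using that a0 by (simp add: norm_exp_eq_Re mult_nonneg_nonpos)
  thus ?thesis
    using True a0 by (intro exI[of _ "Ln (a 0)"]) auto
next
  case False
  hence M: "0 < M" using M by simp
  have "(\<lambda>n. 1 - norm (a n)) \<longlonglongrightarrow> 1 - 1"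
    by (intro tendsto_intros iterated_square_roots_norm_tendsto_1 sq a0)
  hence "\<forall>\<^sub>F n in sequentially. 1 - norm (a n) < M"
    using M by (intro order_tendstoD(2)) auto
  then obtain N where N: "\<And>n. N \<le> n \<Longrightarrow> 1 - norm (a n) < M"
    by (auto simp: eventually_sequentially)
  have re: "0 < Re (a (N + n))" for n
  proof -
    have "M * norm (1 - a (N + n)) < M * 1"
      using stolz[of "N + n"] N[of "N + n"] by simp
    hence "norm (1 - a (N + n)) < 1"
      using M by simp
    thus ?thesis
      using complex_Re_le_cmod[of "1 - a (N + n)"] by simp
  qed
  define c where "c = 2 ^ N * Ln (a N)"
  have roots: "a (N + n) = exp (of_real (1 / 2 ^ (N + n)) * c)" for n
  proof -
    have "a (N + n) = exp (Ln (a N) / 2 ^ n)"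
      using square_roots_eventually_principal[of "\<lambda>n. a (N + n)" n] sq re by simp
    thus ?thesis
      by (simp add: c_def power_add)
  qed
  have "a N \<noteq> 0"
    using re[of 0] by auto
  hence "exp c = a N ^ (2 ^ N)"
    unfolding c_def using exp_of_nat_mult[of "2 ^ N" "Ln (a N)"] by simp
  hence exp_c: "exp c = a 0"
    using iterated_square_roots_power[of a 0 N, OF sq] by simp
  have "M * norm (1 - exp (of_real t * c)) \<le> 1 - norm (exp (of_real t * c))" if t: "0 \<le> t" for t
  proof -
    define e :: "nat \<Rightarrow> real" where "e n = (1 / 2) ^ (N + n)" for n
    define u where "u n = of_nat (nat \<lfloor>t / e n\<rfloor>) * e n" for n
    have "(\<lambda>n. (1 / 2 :: real) ^ (n + N)) \<longlonglongrightarrow> 0"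
      by (rule LIMSEQ_ignore_initial_segment[OF LIMSEQ_realpow_zero]) auto
    hence e0: "e \<longlonglongrightarrow> 0"
      by (simp add: e_def[abs_def] add.commute)
    have e_pos: "0 < e n" for n
      by (simp add: e_def)
    have u: "u \<longlonglongrightarrow> t"
      unfolding u_def by (rule floor_multiple_tendsto[OF e0 e_pos t])
    have "M * norm (1 - exp (of_real (u n) * c)) \<le> 1 - norm (exp (of_real (u n) * c))" for n
    proof -
      have "exp (of_real (u n) * c) = a (N + n) ^ nat \<lfloor>t / e n\<rfloor>"
        unfolding roots u_def e_def
        by (simp add: exp_of_nat_mult[symmetric] mult.assoc power_one_over)
      thus ?thesis
        using stolz_condition_power[OF stolz less_imp_le[OF M]] by simp
    qed
    moreover have "(\<lambda>n. M * norm (1 - exp (of_real (u n) * c))) \<longlonglongrightarrow> M * norm (1 - exp (of_real t * c))"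
      by (intro tendsto_intros u)
    moreover have "(\<lambda>n. 1 - norm (exp (of_real (u n) * c))) \<longlonglongrightarrow> 1 - norm (exp (of_real t * c))"
      by (intro tendsto_intros u)
    ultimately show ?thesis
      using LIMSEQ_le by blast
  qed
  thus ?thesis
    using exp_c by blast
qed

section \<open>Conjugation to the origin\<close>

lemma fractional_linear_on_inj:
  assumes "fractional_linear_on S f"
  shows "inj_on f S"
proof (rule inj_onI)
  obtain a b c d where det: "a * d - b * c \<noteq> 0"
    and f: "\<And>z. z \<in> S \<Longrightarrow> c * z + d \<noteq> 0 \<and> f z = (a * z + b) / (c * z + d)"
    using assms unfolding fractional_linear_on_def by metis
  fix z w assume "z \<in> S" "w \<in> S" "f z = f w"
  hence "(a * z + b) * (c * w + d) = (a * w + b) * (c * z + d)"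
    using f by (simp add: frac_eq_eq)
  hence "(a * d - b * c) * (z - w) = 0"
    by algebra
  thus "z = w"
    using det by simp
qed

text \<open>
  Conjugation keeps the map fractional linear and moves its fixed point to \<open>0\<close>. The denominator does
  not vanish at \<open>0\<close>, so its constant term can be normalised to \<open>1\<close>.
\<close>

lemma conjugate_form_exists:
  assumes lf: "linear_fractional_self_map \<phi>" and p: "p \<in> unit_disk" and fix_p: "\<phi> p = p"
  shows "\<exists>A C. conjugate_form \<phi> p A C"
proof -
  interpret disk_chart unit_disk "disk_involution p" "disk_involution p"
    by (rule disk_chart_involution) (use p in simp)
  define f where "f = disk_involution p \<circ> \<phi> \<circ> disk_involution p"
  have sm: "self_map \<phi>"
    using lf by (simp add: linear_fractional_self_map_def)
  have f_into: "f z \<in> unit_disk" if "z \<in> unit_disk" for z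
    unfolding f_def using push_forward_maps_to[OF sm that] .
  have inv: "fractional_linear_on unit_disk (disk_involution p)"
    using fractional_linear_disk_involution p by simp
  have "fractional_linear_on unit_disk \<phi>"
    using lf by (simp add: linear_fractional_self_map_def fractional_linear_on_def)
  hence "fractional_linear_on unit_disk (disk_involution p \<circ> \<phi>)"
    using fractional_linear_on_compose[OF _ inv] self_map_in_disk[OF sm] by blast
  hence "fractional_linear_on unit_disk f"
    unfolding f_def using fractional_linear_on_compose[OF inv] maps_to by blast
  then obtain a b c d where
    form: "\<And>z. z \<in> unit_disk \<Longrightarrow> c * z + d \<noteq> 0 \<and> f z = (a * z + b) / (c * z + d)"
    unfolding fractional_linear_on_def by metis
  have "f 0 = 0"
    using fix_p by (simp add: f_def disk_involution_def)
  hence d: "d \<noteq> 0" and b: "b = 0"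
    using form[of 0] by auto
  have den: "c / d * z + 1 = (c * z + d) / d" for z
    using d by (simp add: field_simps)
  have nz: "c / d * z + 1 \<noteq> 0" if "z \<in> unit_disk" for z
    unfolding den using form[OF that] d by simp
  have eq: "f z = a / d * z / (c / d * z + 1)" if "z \<in> unit_disk" for z
    unfolding den using form[OF that] d b by simp
  have "norm (a / d) + norm (c / d) \<le> 1"
    by (rule norm_bound_of_self_map_fixing_zero) (use nz f_into eq in metis)+
  hence "conjugate_form \<phi> p (a / d) (c / d)"
    unfolding conjugate_form_def f_def[symmetric] using nz eq by blast
  thus ?thesis
    by blast
qed

locale conjugated_map = disk_chart unit_disk "disk_involution p" "disk_involution p" for p +
  fixes \<phi> :: "complex \<Rightarrow> complex" and A C :: complex
  assumes p: "p \<in> unit_disk"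
    and lf: "linear_fractional_self_map \<phi>"
    and not_aut: "\<not> disk_automorphism \<phi>"
    and form: "conjugate_form \<phi> p A C"
begin

lemma self_map: "self_map \<phi>"
  using lf by (simp add: linear_fractional_self_map_def)

lemma norm_bound: "norm A + norm C \<le> 1"
  using form by (simp add: conjugate_form_def)

lemma conjugate_eq:
  "z \<in> unit_disk \<Longrightarrow> disk_involution p (\<phi> (disk_involution p z)) = A * z / (C * z + 1)"
  using form by (simp add: conjugate_form_def)

lemma map_eq:
  assumes "z \<in> unit_disk"
  shows "\<phi> z = disk_involution p (A * disk_involution p z / (C * disk_involution p z + 1))"
  using conjugate_eq[OF maps_to[OF assms]] left_inv assms self_map_in_disk[OF self_map assms]
  by metis

lemma multiplier_nonzero: "A \<noteq> 0"
proof
  assume "A = 0"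
  hence "\<phi> 0 = \<phi> (1 / 2)"
    using map_eq[of 0] map_eq[of "1 / 2"] by (simp add: norm_divide)
  moreover have "inj_on \<phi> unit_disk"
    by (rule fractional_linear_on_inj)
      (use lf in \<open>simp add: linear_fractional_self_map_def fractional_linear_on_def\<close>)
  moreover have "(0 :: complex) \<in> unit_disk" "(1 / 2 :: complex) \<in> unit_disk"
    by (simp_all add: norm_divide)
  ultimately have "(0 :: complex) = 1 / 2"
    by (metis inj_onD)
  thus False
    by simp
qed

text \<open>
  A multiplier of modulus \<open>1\<close> leaves no room for \<open>C\<close>, and then \<open>\<phi>\<close> would be conjugate to a rotation.
\<close>

lemma multiplier_norm_less_1: "norm A < 1"
proof (rule ccontr)
  assume "\<not> norm A < 1"
  moreover have "norm A \<le> 1"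
    using norm_bound norm_ge_zero[of C] by linarith
  ultimately have A: "norm A = 1"
    by simp
  hence C: "C = 0"
    using norm_bound by simp
  have rot: "A * z \<in> unit_disk" "z / A \<in> unit_disk" if "z \<in> unit_disk" for z
    using that A by (simp_all add: norm_mult norm_divide)
  have eq: "\<phi> z = disk_involution p (A * disk_involution p z)" if "z \<in> unit_disk" for z
    using map_eq[OF that] C by simp
  have "bij_betw \<phi> unit_disk unit_disk"
  proof (rule bij_betw_byWitness[where f' = "\<lambda>z. disk_involution p (disk_involution p z / A)"])
    show "\<forall>z\<in>unit_disk. disk_involution p (disk_involution p (\<phi> z) / A) = z"
    proof
      fix z assume z: "z \<in> unit_disk"
      show "disk_involution p (disk_involution p (\<phi> z) / A) = z"
        using left_inv[OF rot(1)[OF maps_to[OF z]]] left_inv[OF z] multiplier_nonzero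
        by (simp add: eq[OF z])
    qed
    show "\<forall>z\<in>unit_disk. \<phi> (disk_involution p (disk_involution p z / A)) = z"
    proof
      fix z assume z: "z \<in> unit_disk"
      note r = rot(2)[OF maps_to[OF z]]
      show "\<phi> (disk_involution p (disk_involution p z / A)) = z"
        using eq[OF maps_to[OF r]] left_inv[OF r] left_inv[OF z] multiplier_nonzero by simp
    qed
    show "\<phi> ` unit_disk \<subseteq> unit_disk"
      using self_map_in_disk[OF self_map] by blast
    show "(\<lambda>z. disk_involution p (disk_involution p z / A)) ` unit_disk \<subseteq> unit_disk"
      using maps_to rot(2) by blast
  qed
  thus False
    using not_aut self_map by (simp add: disk_automorphism_def)
qed

lemma multiplier_neq_1: "A \<noteq> 1"
  using multiplier_norm_less_1 by auto

definition slope :: complex where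
  "slope = C / (1 - A)"

lemma slope_eq: "(1 - A) * slope = C"
  using multiplier_neq_1 by (simp add: slope_def)

lemma norm_slope_le_1: "norm slope \<le> 1"
proof -
  have "norm C \<le> 1 - norm A"
    using norm_bound by simp
  also have "\<dots> \<le> norm (1 - A)"
    using norm_triangle_ineq2[of 1 A] by simp
  finally show ?thesis
    using multiplier_neq_1 by (simp add: slope_def norm_divide divide_le_eq_1)
qed

lemma conjugate_eq_linear_model: "A * z / (C * z + 1) = linear_model slope A z"
  by (simp add: linear_model_def slope_eq)

lemma conjugate_maps_to: "z \<in> unit_disk \<Longrightarrow> linear_model slope A z \<in> unit_disk"
  using self_map_fixing_zero_of_norm_bound(2)[OF norm_bound] by (simp flip: conjugate_eq_linear_model)

lemma linearizer_conjugate: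
  "z \<in> unit_disk \<Longrightarrow> linearizer slope (linear_model slope A z) = A * linearizer slope z"
  using linearizer_linear_model[OF norm_slope_le_1] self_map_fixing_zero_of_norm_bound(1)[OF norm_bound]
  by (simp add: slope_eq)

lemma mem_root_region_iff:
  "z \<in> root_region A C \<longleftrightarrow> norm z < 1 \<and> norm slope * norm (1 - z) \<le> 1 - norm z"
  by (simp add: root_region_def slope_def norm_divide)

text \<open>
  Every member of the semigroup commutes with \<open>\<phi>\<close>, hence fixes the only fixed point of \<open>\<phi>\<close> and is
  linearized by the same function. Its multiplier \<open>m r\<close> satisfies \<open>m (2 r) = (m r)\<^sup>2\<close>, so halving the
  time takes square roots, and being a self-map puts \<open>m r\<close> in the region.
\<close>

lemma semigroup_imp_root_sequence:
  assumes g: "disk_semigroup g" and mem: "member_of_semigroup \<phi> g"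
  shows "\<exists>a :: nat \<Rightarrow> complex. a 0 = A \<and> (\<forall>n\<ge>1. (a n)\<^sup>2 = a (n - 1)) \<and> (\<forall>n. a n \<in> root_region A C)"
proof -
  obtain t where t: "0 \<le> t" "eq_on_disk \<phi> (g t)"
    using mem by (auto simp: member_of_semigroup_def)
  define G where "G r = disk_involution p \<circ> g r \<circ> disk_involution p" for r
  have G_sm: "self_map (G r)" if "0 \<le> r" for r
    unfolding G_def
  proof (rule self_map_pull_back)
    show "g r holomorphic_on unit_disk"
      using disk_semigroup_self_map[OF g that] by (simp add: self_map_def)
  qed (rule self_map_in_disk[OF disk_semigroup_self_map[OF g that]])
  have G_into: "G r z \<in> unit_disk" if "0 \<le> r" "z \<in> unit_disk" for r z
    using self_map_in_disk[OF G_sm[OF that(1)] that(2)] .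
  have G_add: "G r (G s z) = G (r + s) z" if "0 \<le> r" "0 \<le> s" "z \<in> unit_disk" for r s z
  proof -
    have "g s (disk_involution p z) \<in> unit_disk"
      using self_map_in_disk[OF disk_semigroup_self_map[OF g that(2)] maps_to[OF that(3)]] .
    thus ?thesis
      using left_inv disk_semigroup_add[OF g that(1,2) maps_to[OF that(3)]] by (simp add: G_def)
  qed
  have G_t: "G t z = linear_model slope A z" if "z \<in> unit_disk" for z
    using conjugate_eq[OF that] conjugate_eq_linear_model t(2) maps_to[OF that]
    by (simp add: G_def eq_on_disk_def)
  have comm: "G r (linear_model slope A z) = linear_model slope A (G r z)"
    if "0 \<le> r" "z \<in> unit_disk" for r z
    using G_add[OF that(1) t(1) that(2)] G_add[OF t(1) that] G_t[OF that(2)] G_t[OF G_into[OF that]]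
    by (simp add: add.commute)
  have zero: "G r 0 = 0" if "0 \<le> r" for r
  proof -
    have in_disk: "G r 0 \<in> unit_disk"
      using G_into[OF that] by simp
    have "linear_model slope A (G r 0) = G r 0"
      using comm[OF that, of 0] by (simp add: linear_model_def)
    hence "linearizer slope (G r 0) = A * linearizer slope (G r 0)"
      using linearizer_conjugate[OF in_disk] by simp
    hence "linearizer slope (G r 0) = 0"
      using multiplier_neq_1 by simp
    thus ?thesis
      using linearizer_denominator_nonzero[OF norm_slope_le_1 in_disk] by (simp add: linearizer_def)
  qed
  have "\<exists>a. \<forall>z\<in>unit_disk. linearizer slope (G r z) = a * linearizer slope z" if "0 \<le> r" for r
    by (rule commuting_with_linear_model[OF norm_slope_le_1 multiplier_nonzero multiplier_norm_less_1
          conjugate_maps_to linearizer_conjugate G_sm[OF that] zero[OF that] comm[OF that]])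
  then obtain m where m: "\<And>r z. 0 \<le> r \<Longrightarrow> z \<in> unit_disk \<Longrightarrow>
      linearizer slope (G r z) = m r * linearizer slope z"
    by metis
  have half: "(1 / 2 :: complex) \<in> unit_disk"
    by (simp add: norm_divide)
  have lin_half: "linearizer slope (1 / 2) \<noteq> 0"
    using linearizer_denominator_nonzero[OF norm_slope_le_1 half]
    unfolding linearizer_def divide_eq_0_iff by simp
  define a where "a n = m (t / 2 ^ n)" for n :: nat
  have t_n: "0 \<le> t / 2 ^ n" for n :: nat
    using t by simp
  have a0: "a 0 = A"
    using m[OF t(1) half] linearizer_conjugate[OF half] G_t[OF half] lin_half by (simp add: a_def)
  have sq: "(a (Suc n))\<^sup>2 = a n" for n
  proof -
    define r where "r = t / 2 ^ Suc n"
    have r: "0 \<le> r" "r + r = t / 2 ^ n"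
      using t by (simp_all add: r_def)
    have "m (r + r) * linearizer slope (1 / 2) = linearizer slope (G r (G r (1 / 2)))"
      using m[of "r + r", OF _ half] G_add[OF r(1) r(1) half] r(1) by simp
    also have "\<dots> = (m r)\<^sup>2 * linearizer slope (1 / 2)"
      using m[OF r(1) half] m[OF r(1) G_into[OF r(1) half]] by (simp add: power2_eq_square)
    finally have "m (r + r) = (m r)\<^sup>2"
      using lin_half by simp
    thus ?thesis
      unfolding a_def r(2) by (simp add: r_def)
  qed
  have pow: "a n ^ (2 ^ n) = A" for n
    using iterated_square_roots_power[where a = a and m = 0 and n = n, OF sq] a0 by simp
  have "a n \<in> root_region A C" for n
    unfolding mem_root_region_iff
  proof
    have "norm (a n) ^ (2 ^ n) < 1"
      using pow[of n] multiplier_norm_less_1 by (simp flip: norm_power)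
    thus "norm (a n) < 1"
      using one_le_power[of "norm (a n)" "2 ^ n"] by linarith
    have nz: "a n \<noteq> 0"
      using pow[of n] multiplier_nonzero by (metis power_eq_0_iff zero_less_numeral zero_less_power power_0_left)
    have lin: "linearizer slope (G (t / 2 ^ n) z) = a n * linearizer slope z" if "z \<in> unit_disk" for z
      using m[OF t_n that] by (simp add: a_def)
    have "norm (a n) + norm ((1 - a n) * slope) \<le> 1"
    proof (rule norm_bound_of_self_map_fixing_zero)
      fix z assume z: "z \<in> unit_disk"
      show "(1 - a n) * slope * z + 1 \<noteq> 0"
        using linearizer_eqD(1)[OF norm_slope_le_1 z G_into[OF t_n z] lin[OF z] nz] .
      show "a n * z / ((1 - a n) * slope * z + 1) \<in> unit_disk"
        using linearizer_eqD(2)[OF norm_slope_le_1 z G_into[OF t_n z] lin[OF z] nz] G_into[OF t_n z]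
        by (metis linear_model_def)
    qed
    thus "norm slope * norm (1 - a n) \<le> 1 - norm (a n)"
      by (simp add: norm_mult mult.commute)
  qed
  moreover have "\<forall>n\<ge>1. (a n)\<^sup>2 = a (n - 1)"
    using sq by (metis Suc_diff_1 less_eq_Suc_le One_nat_def)
  ultimately show ?thesis
    using a0 by blast
qed

lemma root_sequence_imp_semigroup:
  fixes a :: "nat \<Rightarrow> complex"
  assumes a0: "a 0 = A" and sq: "\<forall>n\<ge>1. (a n)\<^sup>2 = a (n - 1)" and mem: "\<forall>n. a n \<in> root_region A C"
  shows "\<exists>g. disk_semigroup g \<and> member_of_semigroup \<phi> g"
proof -
  have "(a (Suc n))\<^sup>2 = a n" for n
    using sq[rule_format, of "Suc n"] by simp
  moreover have "norm slope * norm (1 - a n) \<le> 1 - norm (a n)" for n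
    using mem by (simp add: mem_root_region_iff)
  ultimately obtain c where c: "exp c = A"
    "\<forall>t\<ge>0. norm slope * norm (1 - exp (of_real t * c)) \<le> 1 - norm (exp (of_real t * c))"
    using square_roots_give_exponent[of a "norm slope"] a0 multiplier_nonzero multiplier_norm_less_1
    by auto
  let ?g = "\<lambda>t. disk_involution p \<circ> linear_model slope (exp (of_real t * c)) \<circ> disk_involution p"
  have "disk_semigroup ?g"
  proof (rule linear_model_semigroup)
    show "norm p < 1"
      using p by simp
    fix t :: real assume "0 \<le> t"
    with c(2) have "norm slope * norm (1 - exp (of_real t * c)) \<le> 1 - norm (exp (of_real t * c))"
      by blast
    thus "norm (exp (of_real t * c)) + norm ((1 - exp (of_real t * c)) * slope) \<le> 1"
      by (simp add: norm_mult mult.commute)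
  qed
  moreover have "member_of_semigroup \<phi> ?g"
    unfolding member_of_semigroup_def eq_on_disk_def
    by (rule exI[of _ 1]) (use map_eq c(1) in \<open>simp add: conjugate_eq_linear_model\<close>)
  ultimately show ?thesis
    by blast
qed

end

section \<open>Semigroups through elliptic automorphisms\<close>

lemma rotation_semigroup:
  assumes "norm p < 1"
  shows "disk_semigroup (\<lambda>t. disk_involution p \<circ> (\<lambda>z. exp (\<i> * of_real (t * x)) * z) \<circ> disk_involution p)"
proof -
  have "norm (exp (of_real t * (\<i> * of_real x))) = 1" for t
    by (simp add: norm_exp_eq_Re)
  hence "disk_semigroup (\<lambda>t. disk_involution p \<circ> linear_model 0 (exp (of_real t * (\<i> * of_real x)))
      \<circ> disk_involution p)"
    by (intro linear_model_semigroup[OF assms]) simp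
  thus ?thesis
    by (simp add: linear_model_def[abs_def] mult.left_commute)
qed

lemma elliptic_automorphism_in_semigroup:
  assumes "elliptic \<phi>" "disk_automorphism \<phi>"
  shows "\<exists>g. disk_semigroup g \<and> member_of_semigroup \<phi> g"
proof -
  obtain p where p: "p \<in> unit_disk" "\<phi> p = p"
    using assms by (auto simp: elliptic_def)
  have sm: "self_map \<phi>" and bij: "bij_betw \<phi> unit_disk unit_disk"
    using assms by (auto simp: disk_automorphism_def)
  interpret disk_chart unit_disk "disk_involution p" "disk_involution p"
    by (rule disk_chart_involution) (use p in simp)
  have bijp: "bij_betw (disk_involution p) unit_disk unit_disk"
    by (rule bij_betw_byWitness[where f' = "disk_involution p"])
      (use maps_to left_inv in auto)
  obtain l where l: "norm l = 1"
    "\<And>z. z \<in> unit_disk \<Longrightarrow> (disk_involution p \<circ> \<phi> \<circ> disk_involution p) z = l * z"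
  proof (rule disk_automorphism_fixing_zero_is_rotation)
    show "disk_involution p \<circ> \<phi> \<circ> disk_involution p holomorphic_on unit_disk"
      by (rule push_forward_holomorphic[OF sm])
    show "bij_betw (disk_involution p \<circ> \<phi> \<circ> disk_involution p) unit_disk unit_disk"
      by (intro bij_betw_trans[OF bijp] bij_betw_trans[OF bij] bijp)
    show "(disk_involution p \<circ> \<phi> \<circ> disk_involution p) 0 = 0"
      using p by (simp add: disk_involution_def)
  qed blast
  have exp_l: "exp (\<i> * of_real (Arg l)) = l"
    using l(1) Arg_eq[of l] by force
  let ?g = "\<lambda>t. disk_involution p \<circ> (\<lambda>z. exp (\<i> * of_real (t * Arg l)) * z) \<circ> disk_involution p"
  have "disk_semigroup ?g"
    using rotation_semigroup p by simp
  moreover have "\<phi> z = ?g 1 z" if z: "z \<in> unit_disk" for z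
  proof -
    have "disk_involution p (\<phi> z) = l * disk_involution p z"
      using l(2)[OF maps_to[OF z]] left_inv[OF z] by simp
    thus ?thesis
      using left_inv[OF self_map_in_disk[OF sm z]] exp_l by (metis comp_apply mult_1)
  qed
  hence "member_of_semigroup \<phi> ?g"
    unfolding member_of_semigroup_def eq_on_disk_def by (intro exI[of _ 1]) auto
  ultimately show ?thesis
    by blast
qed

text \<open>
  The half turn is reached at time \<open>1\<close> by rotating in either direction; at time \<open>1 / 2\<close> the two
  semigroups differ.
\<close>

lemma elliptic_automorphism_semigroup_not_unique:
  "\<exists>\<phi> s g h. elliptic \<phi> \<and> disk_automorphism \<phi> \<and> s > 0 \<and>
     disk_semigroup g \<and> eq_on_disk (g s) \<phi> \<and>
     disk_semigroup h \<and> eq_on_disk (h s) \<phi> \<and> \<not> eq_semigroup g h"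
proof -
  let ?g = "\<lambda>x t z :: complex. exp (\<i> * of_real (t * x)) * z"
  have sg: "disk_semigroup (?g x)" for x
    using rotation_semigroup[of 0 x] by (simp add: disk_involution_def comp_def)
  have sm: "self_map uminus"
    by (auto simp: self_map_def intro!: holomorphic_intros)
  have half: "(1 / 2 :: complex) \<in> unit_disk"
    by (simp add: norm_divide)
  have "elliptic uminus"
    unfolding elliptic_def eq_on_disk_def using sm half by (auto intro!: bexI[of _ "1 / 2"])
  moreover have "disk_automorphism uminus"
    unfolding disk_automorphism_def using sm
    by (auto intro!: bij_betw_byWitness[where f' = uminus])
  moreover have "eq_on_disk (?g pi 1) uminus" "eq_on_disk (?g (- pi) 1) uminus"
    by (simp_all add: eq_on_disk_def exp_minus)
  moreover have "\<not> eq_semigroup (?g pi) (?g (- pi))"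
  proof
    assume "eq_semigroup (?g pi) (?g (- pi))"
    hence "?g pi (1 / 2) (1 / 2) = ?g (- pi) (1 / 2) (1 / 2)"
      unfolding eq_semigroup_def eq_on_disk_def using half by (metis half_gt_zero less_eq_real_def zero_less_one)
    hence "cis (pi / 2) = cis (- (pi / 2))"
      by (simp add: cis_conv_exp)
    thus False
      by (simp add: complex_eq_iff)
  qed
  ultimately show ?thesis
    using sg zero_less_one by blast
qed

section \<open>Embedding fractional linear self-maps into semigroups\<close>

theorem corollary1:
  shows
    "(\<forall>\<phi> s. linear_fractional_self_map \<phi> \<and> (parabolic \<phi> \<or> hyperbolic \<phi>) \<and> s > 0 \<longrightarrow>
        (\<exists>g. disk_semigroup g \<and> eq_on_disk (g s) \<phi> \<and>
             (\<forall>h. disk_semigroup h \<and> eq_on_disk (h s) \<phi> \<longrightarrow> eq_semigroup h g))) \<and>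
     (\<forall>\<phi>. elliptic \<phi> \<and> disk_automorphism \<phi> \<longrightarrow>
        (\<exists>g. disk_semigroup g \<and> member_of_semigroup \<phi> g)) \<and>
     (\<exists>\<phi> s g h. elliptic \<phi> \<and> disk_automorphism \<phi> \<and> s > 0 \<and>
        disk_semigroup g \<and> eq_on_disk (g s) \<phi> \<and>
        disk_semigroup h \<and> eq_on_disk (h s) \<phi> \<and> \<not> eq_semigroup g h) \<and>
     (\<forall>\<phi> p. elliptic \<phi> \<and> \<not> disk_automorphism \<phi> \<and> linear_fractional_self_map \<phi> \<and>
          denjoy_wolff_point \<phi> p \<longrightarrow>
        (\<exists>A C. conjugate_form \<phi> p A C) \<and>
        (\<forall>A C. conjugate_form \<phi> p A C \<longrightarrow>
          ((\<exists>g. disk_semigroup g \<and> member_of_semigroup \<phi> g) \<longleftrightarrow>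
           (\<exists>a :: nat \<Rightarrow> complex. a 0 = A \<and> (\<forall>n\<ge>1. (a n)\<^sup>2 = a (n - 1)) \<and>
              (\<forall>n. a n \<in> root_region A C)))))"
proof (intro conjI allI impI)
  fix \<phi> :: "complex \<Rightarrow> complex" and s :: real
  assume "linear_fractional_self_map \<phi> \<and> (parabolic \<phi> \<or> hyperbolic \<phi>) \<and> s > 0"
  then obtain p where lf: "linear_fractional_self_map \<phi>" and ne: "\<not> elliptic \<phi>"
    and dw: "denjoy_wolff_point \<phi> p" and s: "s > 0"
    by (auto simp: parabolic_def hyperbolic_def)
  show "\<exists>g. disk_semigroup g \<and> eq_on_disk (g s) \<phi> \<and>
      (\<forall>h. disk_semigroup h \<and> eq_on_disk (h s) \<phi> \<longrightarrow> eq_semigroup h g)"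
    using non_elliptic_semigroup_exists[OF lf ne dw s] non_elliptic_semigroup_unique[OF lf ne dw s]
    by blast
next
  fix \<phi> assume "elliptic \<phi> \<and> disk_automorphism \<phi>"
  thus "\<exists>g. disk_semigroup g \<and> member_of_semigroup \<phi> g"
    using elliptic_automorphism_in_semigroup by blast
next
  show "\<exists>\<phi> s g h. elliptic \<phi> \<and> disk_automorphism \<phi> \<and> s > 0 \<and>
        disk_semigroup g \<and> eq_on_disk (g s) \<phi> \<and>
        disk_semigroup h \<and> eq_on_disk (h s) \<phi> \<and> \<not> eq_semigroup g h"
    by (rule elliptic_automorphism_semigroup_not_unique)
next
  fix \<phi> p
  assume "elliptic \<phi> \<and> \<not> disk_automorphism \<phi> \<and> linear_fractional_self_map \<phi> \<and>
    denjoy_wolff_point \<phi> p"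
  hence na: "\<not> disk_automorphism \<phi>" and lf: "linear_fractional_self_map \<phi>"
    and p: "p \<in> unit_disk" "\<phi> p = p"
    by (auto simp: denjoy_wolff_point_def)
  show "\<exists>A C. conjugate_form \<phi> p A C"
    by (rule conjugate_form_exists[OF lf p])
  fix A C assume form: "conjugate_form \<phi> p A C"
  interpret disk_chart unit_disk "disk_involution p" "disk_involution p"
    by (rule disk_chart_involution) (use p in simp)
  interpret conjugated_map p \<phi> A C
    by unfold_locales (use p lf na form in auto)
  show "(\<exists>g. disk_semigroup g \<and> member_of_semigroup \<phi> g) \<longleftrightarrow>
      (\<exists>a :: nat \<Rightarrow> complex. a 0 = A \<and> (\<forall>n\<ge>1. (a n)\<^sup>2 = a (n - 1)) \<and>
        (\<forall>n. a n \<in> root_region A C))"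
    using semigroup_imp_root_sequence root_sequence_imp_semigroup by blast
qed

end
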